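(* Let $A$ be a $C^*$-algebra and let $p\in[1,\infty)\setminus\{2\}$. Then $A$ admits an isometric representation on an $L^p$-space if and only if $A$ is commutative.
   Context: A representation is a bounded linear multiplicative map into the bounded operators on a Banach space; an $L^p$-space means $L^p(\mu)$ for some measure space. *)

theory Defs
  imports "HOL-Analysis.Analysis"
begin

definition cstar_algebra :: "(complex \<Rightarrow> 'a::{real_normed_algebra,banach} \<Rightarrow> 'a) \<Rightarrow> ('a \<Rightarrow> 'a) \<Rightarrow> bool" where
  "cstar_algebra sm st \<longleftrightarrow>
     (\<forall>(r::real) (a::'a). sm (complex_of_real r) a = r *\<^sub>R a) \<and>
     (\<forall>c a b. sm c (a + b) = sm c a + sm c b) \<and>
     (\<forall>c d a. sm (c + d) a = sm c a + sm d a) \<and>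
     (\<forall>c d a. sm (c * d) a = sm c (sm d a)) \<and>
     (\<forall>a. sm 1 a = a) \<and>
     (\<forall>c a b. sm c (a * b) = sm c a * b \<and> sm c (a * b) = a * sm c b) \<and>
     (\<forall>c a. norm (sm c a) = cmod c * norm a) \<and>
     (\<forall>a. st (st a) = a) \<and>
     (\<forall>a b. st (a + b) = st a + st b) \<and>
     (\<forall>c a. st (sm c a) = sm (cnj c) (st a)) \<and>
     (\<forall>a b. st (a * b) = st b * st a) \<and>
     (\<forall>a. norm (st a * a) = (norm a)\<^sup>2)"

definition commutative_alg :: "'a::times itself \<Rightarrow> bool" where
  "commutative_alg _ \<longleftrightarrow> (\<forall>a b :: 'a. a * b = b * a)"

text \<open>Complex L^p(M): measurable functions with integrable p-th power of the modulus;
elements are identified up to M-a.e. equality (handled in the operator conditions).\<close>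

definition Lp_space :: "'m measure \<Rightarrow> real \<Rightarrow> ('m \<Rightarrow> complex) set" where
  "Lp_space M p = {f. f \<in> borel_measurable M \<and> integrable M (\<lambda>x. cmod (f x) powr p)}"

definition Lp_norm :: "'m measure \<Rightarrow> real \<Rightarrow> ('m \<Rightarrow> complex) \<Rightarrow> real" where
  "Lp_norm M p f = (\<integral>x. cmod (f x) powr p \<partial>M) powr (1 / p)"

definition isometric_Lp_rep ::
  "'m measure \<Rightarrow> real \<Rightarrow> (complex \<Rightarrow> 'a \<Rightarrow> 'a) \<Rightarrow> ('a::{real_normed_algebra} \<Rightarrow> ('m \<Rightarrow> complex) \<Rightarrow> ('m \<Rightarrow> complex)) \<Rightarrow> bool" where
  "isometric_Lp_rep M p sm \<pi> \<longleftrightarrow>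
     (\<forall>a. \<forall>f\<in>Lp_space M p. \<pi> a f \<in> Lp_space M p) \<and>
     (\<forall>a. \<forall>f\<in>Lp_space M p. \<forall>g\<in>Lp_space M p.
         (AE x in M. f x = g x) \<longrightarrow> (AE x in M. \<pi> a f x = \<pi> a g x)) \<and>
     (\<forall>a c. \<forall>f\<in>Lp_space M p. \<forall>g\<in>Lp_space M p.
         AE x in M. \<pi> a (\<lambda>y. c * f y + g y) x = c * \<pi> a f x + \<pi> a g x) \<and>
     (\<forall>a b. \<forall>f\<in>Lp_space M p. AE x in M. \<pi> (a + b) f x = \<pi> a f x + \<pi> b f x) \<and>
     (\<forall>a c. \<forall>f\<in>Lp_space M p. AE x in M. \<pi> (sm c a) f x = c * \<pi> a f x) \<and>
     (\<forall>a b. \<forall>f\<in>Lp_space M p. AE x in M. \<pi> (a * b) f x = \<pi> a (\<pi> b f) x) \<and>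
     (\<forall>a. (\<forall>f\<in>Lp_space M p. Lp_norm M p (\<pi> a f) \<le> norm a * Lp_norm M p f) \<and>
          (\<forall>K. (\<forall>f\<in>Lp_space M p. Lp_norm M p (\<pi> a f) \<le> K * Lp_norm M p f) \<longrightarrow> norm a \<le> K))"

end

theory Submission
  imports Defs
begin

text \<open>If \<open>A\<close> is commutative, let it act on \<open>\<ell>\<^sup>p\<close> of its set of characters by
  \<open>(a f) \<phi> = \<phi> a \<cdot> f \<phi>\<close>; this is isometric because the norm of every element is attained at a
  character. Characters are obtained from a minimal power-multiplicative seminorm, which turns out to
  be multiplicative, so that an elementary form of the Gelfand--Mazur theorem applies.

  If \<open>A\<close> is not commutative, it contains a nonzero \<open>x\<close> with \<open>x\<^sup>2 = 0\<close>. Indeed, without such elements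
  \<open>f(h) b g(h) = 0\<close> whenever \<open>f g = 0\<close>; hence \<open>[f\<^sub>+(h), b]\<close> and \<open>[f\<^sub>-(h), b]\<close> are orthogonal and
  \<open>[f(h), b]\<close> has the same norm as \<open>[\<bar>f\<bar>(h), b]\<close>. Folding the interval \<open>[- M, M]\<close> repeatedly, by
  \<open>f \<mapsto> \<bar>f\<bar> - M / 2\<^sup>n\<close>, makes this norm arbitrarily small. Functional calculus for \<open>x\<^sup>* x + x x\<^sup>*\<close> then
  produces \<open>a\<close> and \<open>l \<noteq> 0\<close> with \<open>a\<^sup>2 = 0\<close>, \<open>a\<^sup>* l = 0\<close>, \<open>a\<^sup>* a l = l\<close>. In an isometric
  representation take \<open>f\<^sub>1\<close> in the range of \<open>l\<close> and put \<open>f\<^sub>2 = a f\<^sub>1\<close>. The rotations of the plane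
  spanned by \<open>f\<^sub>1\<close> and \<open>\<gamma> f\<^sub>2\<close> with \<open>\<bar>\<gamma>\<bar> = 1\<close> extend to contractions of the whole \<open>L\<^sup>p\<close>, and the
  resulting variational inequality localises: for almost every \<open>x\<close> the values \<open>s = f\<^sub>1 x\<close>,
  \<open>t = f\<^sub>2 x\<close> make
  \<open>\<bar>(s + \<gamma> t) / \<surd>2 + w\<bar>\<^sup>p + \<bar>(s - \<gamma> t) / \<surd>2 + w\<bar>\<^sup>p + 2 \<bar>s - w / \<surd>2\<bar>\<^sup>p\<close> minimal at \<open>w = 0\<close>. For
  \<open>p \<noteq> 2\<close> the derivative in \<open>w\<close> shows that this is impossible unless \<open>s = 0\<close>.\<close>

section \<open>Characters of commutative algebras\<close>

definition pm_seminorm :: "(complex \<Rightarrow> 'r::ring \<Rightarrow> 'r) \<Rightarrow> ('r \<Rightarrow> real) \<Rightarrow> bool" where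
  "pm_seminorm sc \<rho> \<longleftrightarrow>
     (\<forall>a b. \<rho> (a + b) \<le> \<rho> a + \<rho> b) \<and> (\<forall>c a. \<rho> (sc c a) = cmod c * \<rho> a) \<and>
     (\<forall>a b. \<rho> (a * b) \<le> \<rho> a * \<rho> b) \<and> (\<forall>a. \<rho> (a * a) = (\<rho> a)\<^sup>2)"

lemma pm_seminormI:
  assumes "\<And>a b. \<rho> (a + b) \<le> \<rho> a + \<rho> b" "\<And>c a. \<rho> (sc c a) = cmod c * \<rho> a"
    "\<And>a b. \<rho> (a * b) \<le> \<rho> a * \<rho> b" "\<And>a. \<rho> (a * a) = (\<rho> a)\<^sup>2"
  shows "pm_seminorm sc \<rho>"
  using assms by (simp add: pm_seminorm_def)

lemma pm_seminormD:
  assumes "pm_seminorm sc \<rho>"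
  shows "\<rho> (a + b) \<le> \<rho> a + \<rho> b" "\<rho> (sc c a) = cmod c * \<rho> a"
    "\<rho> (a * b) \<le> \<rho> a * \<rho> b" "\<rho> (a * a) = (\<rho> a)\<^sup>2"
  using assms by (simp_all add: pm_seminorm_def)

text \<open>\<open>sqpow k b\<close> is the power of \<open>b\<close> with exponent
  \<open>2 ^ k\<close>, formed by products alone because a unit may be missing.\<close>

primrec sqpow :: "nat \<Rightarrow> 'r::times \<Rightarrow> 'r" where
  "sqpow 0 b = b"
| "sqpow (Suc k) b = sqpow k b * sqpow k b"

text \<open>The scalar action is a parameter because two algebras are meant: complex polynomials
  with \<open>smult\<close>, and a commutative C*-algebra with \<open>sm\<close>, possibly without a
  unit.\<close>

locale comm_complex_algebra =
  fixes sc :: "complex \<Rightarrow> 'r::ring \<Rightarrow> 'r"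
  assumes sc_add: "sc c (a + b) = sc c a + sc c b"
    and sc_plus: "sc (c + d) a = sc c a + sc d a"
    and sc_mult: "sc (c * d) a = sc c (sc d a)"
    and sc_one: "sc 1 a = a"
    and sc_times: "sc c (a * b) = sc c a * b"
    and commute: "a * b = b * (a::'r)"
begin

lemma sc_zero: "sc 0 a = 0"
  using sc_plus[of 0 0 a] by simp

lemma sc_zero_right: "sc c 0 = 0"
  using sc_add[of c 0 0] by simp

lemma sc_minus: "sc (- c) a = - sc c a"
  using sc_plus[of "- c" c a] by (simp add: sc_zero eq_neg_iff_add_eq_0)

lemma sc_minus_right: "sc c (- a) = - sc c a"
  using sc_add[of c "- a" a] by (simp add: sc_zero_right eq_neg_iff_add_eq_0)

lemma sc_diff: "sc c (a - b) = sc c a - sc c b"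
  using sc_add[of c a "- b"] by (simp add: sc_minus_right)

lemma sc_times_right: "sc c (a * b) = a * sc c b"
  using sc_times[of c b a] commute by metis

context
  fixes \<rho> :: "'r \<Rightarrow> real"
  assumes rho: "pm_seminorm sc \<rho>"
begin

lemma seminorm_uminus: "\<rho> (- a) = \<rho> a"
  using pm_seminormD(2)[OF rho, of "-1" a] by (simp add: sc_minus sc_one)

lemma seminorm_zero: "\<rho> 0 = 0"
  using pm_seminormD(2)[OF rho, of 0 0] by (simp add: sc_zero)

lemma seminorm_nonneg: "0 \<le> \<rho> a"
  using pm_seminormD(1)[OF rho, of a "- a"] by (simp add: seminorm_uminus seminorm_zero)

lemma seminorm_diff_le: "\<rho> (a - b) \<le> \<rho> a + \<rho> b"
  using pm_seminormD(1)[OF rho, of a "- b"] by (simp add: seminorm_uminus)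

lemma seminorm_reverse: "\<bar>\<rho> a - \<rho> b\<bar> \<le> \<rho> (a - b)"
  using pm_seminormD(1)[OF rho, of "a - b" b] pm_seminormD(1)[OF rho, of "b - a" a]
    seminorm_uminus[of "a - b"] by (simp add: abs_le_iff)

lemma seminorm_sqpow: "\<rho> (sqpow k b) = \<rho> b ^ (2 ^ k)"
  by (induction k) (simp_all add: pm_seminormD(4)[OF rho] power_mult[symmetric] mult.commute)

text \<open>\<open>\<sigma> a\<close> is the limit of the decreasing quotients \<rho>(a b^n) /
  \<rho>(b^n) along n = 2^k. Passing from k to k + 1 turns the numerator of a product into a product
  of numerators, so the limit is power-multiplicative again. The last two conclusions exploit
  minimality: the fourth keeps \<open>\<sigma> h\<close> from dropping, the third then bounds
  \<open>\<rho> (a * b)\<close> from below.\<close>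

lemma dominated_by_times:
  assumes b: "\<rho> b > 0"
  obtains \<sigma> where "pm_seminorm sc \<sigma>" "\<And>a. \<sigma> a \<le> \<rho> a"
    "\<And>a. \<sigma> a * \<rho> b \<le> \<rho> (a * b)"
    "\<And>a L. (\<And>k. L * \<rho> (sqpow k b) \<le> \<rho> (a * sqpow k b)) \<Longrightarrow> L \<le> \<sigma> a"
proof -
  have pos: "\<rho> (sqpow k b) > 0" for k
    using b by (simp add: seminorm_sqpow)
  define q where "q k a = \<rho> (a * sqpow k b) / \<rho> (sqpow k b)" for k a
  have q0: "0 \<le> q k a" for k a
    using pos[of k] by (simp add: q_def seminorm_nonneg)
  have step: "q (Suc k) a \<le> q k a" for k a
  proof -
    have "\<rho> (a * (sqpow k b * sqpow k b)) \<le> \<rho> (a * sqpow k b) * \<rho> (sqpow k b)"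
      using pm_seminormD(3)[OF rho, of "a * sqpow k b" "sqpow k b"] by (simp add: mult.assoc)
    then show ?thesis
      using pos[of k] by (simp add: q_def pm_seminormD(4)[OF rho] field_simps power2_eq_square)
  qed
  have dec: "decseq (\<lambda>k. q k a)" for a
    by (rule decseq_SucI) (rule step)
  define \<sigma> where "\<sigma> a = lim (\<lambda>k. q k a)" for a
  have lim: "(\<lambda>k. q k a) \<longlonglongrightarrow> \<sigma> a" for a
  proof -
    have "convergent (\<lambda>k. q k a)"
      by (rule decseq_convergent[OF dec[of a], of 0]) (auto simp: q0 convergent_def)
    then show ?thesis by (simp add: \<sigma>_def convergent_LIMSEQ_iff)
  qed
  have limS: "(\<lambda>k. q (Suc k) a) \<longlonglongrightarrow> \<sigma> a" for a
    using LIMSEQ_Suc[OF lim] .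
  have le: "\<sigma> a \<le> q k a" for a k
    using decseq_ge[OF dec lim] .
  have comm4: "a * c * (d * d) = (a * d) * (c * d)" for a c d :: 'r
    using commute mult.assoc by metis
  show thesis
  proof
    show "pm_seminorm sc \<sigma>"
    proof (rule pm_seminormI)
      fix a c :: 'r and z
      show "\<sigma> (a + c) \<le> \<sigma> a + \<sigma> c"
      proof (rule LIMSEQ_le[OF lim tendsto_add[OF lim lim]], intro exI allI impI)
        fix k
        show "q k (a + c) \<le> q k a + q k c"
          using pm_seminormD(1)[OF rho, of "a * sqpow k b" "c * sqpow k b"] pos[of k]
          by (simp add: q_def distrib_right add_divide_distrib[symmetric] divide_right_mono)
      qed
      have "q k (sc z a) = cmod z * q k a" for k
        by (simp add: q_def sc_times[symmetric] pm_seminormD(2)[OF rho])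
      then have "(\<lambda>k. cmod z * q k a) \<longlonglongrightarrow> \<sigma> (sc z a)"
        using lim[of "sc z a"] by simp
      then show "\<sigma> (sc z a) = cmod z * \<sigma> a"
        using LIMSEQ_unique tendsto_mult_left[OF lim] by blast
      show "\<sigma> (a * c) \<le> \<sigma> a * \<sigma> c"
      proof (rule LIMSEQ_le[OF limS tendsto_mult[OF lim lim]], intro exI allI impI)
        fix k
        show "q (Suc k) (a * c) \<le> q k a * q k c"
          using pm_seminormD(3)[OF rho, of "a * sqpow k b" "c * sqpow k b"] pos[of k]
          by (simp add: q_def comm4[of a c "sqpow k b"] pm_seminormD(4)[OF rho] power2_eq_square divide_right_mono)
      qed
      have "q (Suc k) (a * a) = (q k a)\<^sup>2" for k
        by (simp add: q_def comm4[of a a "sqpow k b"] pm_seminormD(4)[OF rho] power_divide)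
      then have "(\<lambda>k. (q k a)\<^sup>2) \<longlonglongrightarrow> \<sigma> (a * a)"
        using limS[of "a * a"] by simp
      then show "\<sigma> (a * a) = (\<sigma> a)\<^sup>2"
        using LIMSEQ_unique tendsto_power[OF lim] by blast
    qed
    show "\<sigma> a \<le> \<rho> a" for a
    proof -
      have "q 0 a \<le> \<rho> a"
        using pm_seminormD(3)[OF rho, of a b] b by (simp add: q_def field_simps)
      then show ?thesis using le[of a 0] by simp
    qed
    show "\<sigma> a * \<rho> b \<le> \<rho> (a * b)" for a
      using le[of a 0] b by (simp add: q_def field_simps)
    show "L \<le> \<sigma> a" if "\<And>k. L * \<rho> (sqpow k b) \<le> \<rho> (a * sqpow k b)" for a L
      using LIMSEQ_le_const[OF lim, of L a] that pos by (auto simp: q_def pos_le_divide_eq)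
  qed
qed

end

text \<open>Zorn's lemma for the reversed pointwise order. The normalisation is kept as
  \<open>1 \<le> \<rho> h\<close>, which survives infima of chains; equality follows from
  \<open>N h = 1\<close>.\<close>

lemma minimal_seminorm_exists:
  assumes N: "pm_seminorm sc N" and h: "N h = 1"
  obtains \<rho> where "pm_seminorm sc \<rho>" "\<And>a. \<rho> a \<le> N a" "\<rho> h = 1"
    "\<And>\<sigma>. pm_seminorm sc \<sigma> \<Longrightarrow> (\<And>a. \<sigma> a \<le> \<rho> a) \<Longrightarrow> 1 \<le> \<sigma> h \<Longrightarrow> \<sigma> = \<rho>"
proof -
  define S where "S = {\<rho>. pm_seminorm sc \<rho> \<and> (\<forall>a. \<rho> a \<le> N a) \<and> 1 \<le> \<rho> h}"
  have NS: "N \<in> S" using N h by (simp add: S_def)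
  have "\<exists>m\<in>S. \<forall>\<sigma>\<in>S. \<sigma> \<le> m \<longrightarrow> \<sigma> = m"
  proof (rule predicate_Zorn)
    show "partial_order_on S (relation_of (\<lambda>\<rho> \<sigma>. \<sigma> \<le> \<rho>) S)"
      by (rule partial_order_on_relation_ofI) auto
  next
    fix C assume C: "C \<in> Chains (relation_of (\<lambda>\<rho> \<sigma>. \<sigma> \<le> \<rho>) S)"
    show "\<exists>u\<in>S. \<forall>\<rho>\<in>C. u \<le> \<rho>"
    proof (cases "C = {}")
      case True
      then show ?thesis using NS by blast
    next
      case False
      have CS: "C \<subseteq> S" using Chains_relation_of[OF C] .
      have chain: "\<rho> \<le> \<sigma> \<or> \<sigma> \<le> \<rho>" if "\<rho> \<in> C" "\<sigma> \<in> C" for \<rho> \<sigma>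
        using C that unfolding Chains_def relation_of_def by blast
      have sem: "pm_seminorm sc \<rho>" if "\<rho> \<in> C" for \<rho>
        using CS that by (auto simp: S_def)
      have nn: "0 \<le> \<rho> a" if "\<rho> \<in> C" for \<rho> a
        using seminorm_nonneg[OF sem[OF that]] .
      define u where "u a = (INF \<rho>\<in>C. \<rho> a)" for a
      have bdd: "bdd_below ((\<lambda>\<rho>. \<rho> a) ` C)" for a
        using nn by (auto intro!: bdd_belowI[of _ 0])
      have ule: "u a \<le> \<rho> a" if "\<rho> \<in> C" for \<rho> a
        unfolding u_def by (rule cINF_lower[OF bdd that])
      have uge: "x \<le> u a" if "\<And>\<rho>. \<rho> \<in> C \<Longrightarrow> x \<le> \<rho> a" for x a
        unfolding u_def by (rule cINF_greatest[OF False that])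
      have u0: "0 \<le> u a" for a by (rule uge) (rule nn)
      have approx: "\<exists>\<rho>\<in>C. \<rho> a < u a + e" if "e > 0" for a e
        using uge[of "u a + e" a] that by (meson linorder_not_le less_add_same_cancel1)
      have approx2: "\<exists>\<rho>\<in>C. \<rho> a < u a + e \<and> \<rho> b < u b + e" if e: "e > 0" for a b e
      proof -
        obtain \<rho> \<sigma> where *: "\<rho> \<in> C" "\<rho> a < u a + e" "\<sigma> \<in> C" "\<sigma> b < u b + e"
          using approx[OF e] by meson
        then show ?thesis
          using chain[of \<rho> \<sigma>] by (meson le_funD le_less_trans)
      qed
      \<comment> \<open>In a chain the smaller of two members is near both infima. Hence one
        sequence in \<open>C\<close> approaches \<open>u\<close> at two points at once, and each
        axiom passes to the limit along it.\<close>
      have seq: "\<exists>r. (\<forall>n. r n \<in> C) \<and> (\<lambda>n. r n a) \<longlonglongrightarrow> u a \<and> (\<lambda>n. r n b) \<longlonglongrightarrow> u b" for a b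
      proof -
        have "\<forall>n. \<exists>\<rho>\<in>C. \<rho> a < u a + 1 / Suc n \<and> \<rho> b < u b + 1 / Suc n"
          using approx2 by simp
        then obtain r where r: "\<And>n. r n \<in> C" "\<And>n. r n a < u a + 1 / Suc n"
            "\<And>n. r n b < u b + 1 / Suc n"
          by metis
        have lim: "(\<lambda>n. x + 1 / real (Suc n)) \<longlonglongrightarrow> x" for x
          using tendsto_add[OF tendsto_const LIMSEQ_inverse_real_of_nat, of x]
          by (simp add: inverse_eq_divide)
        have "(\<lambda>n. r n a) \<longlonglongrightarrow> u a"
          by (rule tendsto_sandwich[OF _ _ tendsto_const lim])
            (auto intro!: always_eventually ule[OF r(1)] less_imp_le[OF r(2)] simp del: of_nat_Suc)
        moreover have "(\<lambda>n. r n b) \<longlonglongrightarrow> u b"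
          by (rule tendsto_sandwich[OF _ _ tendsto_const lim])
            (auto intro!: always_eventually ule[OF r(1)] less_imp_le[OF r(3)] simp del: of_nat_Suc)
        ultimately show ?thesis using r(1) by blast
      qed
      have "pm_seminorm sc u"
      proof (rule pm_seminormI)
        fix a b :: 'r and c
        obtain r where r: "\<And>n. r n \<in> C" "(\<lambda>n. r n a) \<longlonglongrightarrow> u a" "(\<lambda>n. r n b) \<longlonglongrightarrow> u b"
          using seq by blast
        show "u (a + b) \<le> u a + u b"
          by (rule LIMSEQ_le_const[OF tendsto_add[OF r(2,3)]])
            (meson ule[OF r(1)] pm_seminormD(1)[OF sem[OF r(1)]] order_trans)
        show "u (a * b) \<le> u a * u b"
          by (rule LIMSEQ_le_const[OF tendsto_mult[OF r(2,3)]])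
            (meson ule[OF r(1)] pm_seminormD(3)[OF sem[OF r(1)]] order_trans)
        obtain r where r: "\<And>n. r n \<in> C" "(\<lambda>n. r n a) \<longlonglongrightarrow> u a"
            "(\<lambda>n. r n (sc c a)) \<longlonglongrightarrow> u (sc c a)"
          using seq by blast
        have "(\<lambda>n. r n (sc c a)) \<longlonglongrightarrow> cmod c * u a"
          using tendsto_mult_left[OF r(2), of "cmod c"]
          by (simp add: pm_seminormD(2)[OF sem[OF r(1)]])
        then show "u (sc c a) = cmod c * u a"
          using LIMSEQ_unique r(3) by blast
        obtain r where r: "\<And>n. r n \<in> C" "(\<lambda>n. r n a) \<longlonglongrightarrow> u a"
            "(\<lambda>n. r n (a * a)) \<longlonglongrightarrow> u (a * a)"
          using seq by blast
        have "(\<lambda>n. r n (a * a)) \<longlonglongrightarrow> (u a)\<^sup>2"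
          using tendsto_power[OF r(2), of 2]
          by (simp add: pm_seminormD(4)[OF sem[OF r(1)]])
        then show "u (a * a) = (u a)\<^sup>2"
          using LIMSEQ_unique r(3) by blast
      qed
      moreover have "u a \<le> N a" for a
      proof -
        obtain \<rho> where "\<rho> \<in> C" using False by blast
        moreover from this have "\<rho> a \<le> N a" using CS by (auto simp: S_def)
        ultimately show ?thesis using ule order_trans by blast
      qed
      moreover have "1 \<le> u h"
        using CS by (intro uge) (auto simp: S_def)
      ultimately have "u \<in> S" by (simp add: S_def)
      then show ?thesis using ule by (auto simp: le_fun_def)
    qed
  qed
  then obtain m where m: "m \<in> S" "\<And>\<sigma>. \<sigma> \<in> S \<Longrightarrow> \<sigma> \<le> m \<Longrightarrow> \<sigma> = m" by blast
  show thesis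
  proof
    show *: "pm_seminorm sc m" "\<And>a. m a \<le> N a"
      using m(1) by (auto simp: S_def)
    show "m h = 1"
      using m(1) *(2)[of h] h by (simp add: S_def)
    show "\<sigma> = m" if "pm_seminorm sc \<sigma>" "\<And>a. \<sigma> a \<le> m a" "1 \<le> \<sigma> h" for \<sigma>
      using m that by (intro m(2)) (auto simp: S_def le_fun_def intro: order_trans)
  qed
qed

text \<open>For a minimal \<rho>, the seminorm from \<open>dominated_by_times\<close> must equal
  \<rho>, which gives the missing inequality
  \<open>\<rho> a * \<rho> b \<le> \<rho> (a * b)\<close>. Minimality applies once multiplication by
  \<open>h\<close> does not shrink the powers of \<open>b\<close>. This is checked first for
  \<open>b = h\<close>; the outcome \<open>\<rho> (a * h) = \<rho> a\<close> then settles every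
  \<open>b\<close>.\<close>

lemma multiplicative_seminorm_exists:
  assumes N: "pm_seminorm sc N" and h: "N h = 1"
  obtains \<rho> where "pm_seminorm sc \<rho>" "\<And>a. \<rho> a \<le> N a" "\<rho> h = 1"
    "\<And>a b. \<rho> (a * b) = \<rho> a * \<rho> b"
proof -
  obtain \<rho> where \<rho>: "pm_seminorm sc \<rho>" "\<And>a. \<rho> a \<le> N a" "\<rho> h = 1"
    and min: "\<And>\<sigma>. pm_seminorm sc \<sigma> \<Longrightarrow> (\<And>a. \<sigma> a \<le> \<rho> a) \<Longrightarrow> 1 \<le> \<sigma> h \<Longrightarrow> \<sigma> = \<rho>"
    using minimal_seminorm_exists[OF N h] by blast
  have key: "\<rho> (a * b) = \<rho> a * \<rho> b"
    if b: "\<rho> b > 0" and hb: "\<And>k. \<rho> (sqpow k b) \<le> \<rho> (h * sqpow k b)" for a b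
  proof -
    obtain \<sigma> where \<sigma>: "pm_seminorm sc \<sigma>" "\<And>a. \<sigma> a \<le> \<rho> a" "\<And>a. \<sigma> a * \<rho> b \<le> \<rho> (a * b)"
      "\<And>a L. (\<And>k. L * \<rho> (sqpow k b) \<le> \<rho> (a * sqpow k b)) \<Longrightarrow> L \<le> \<sigma> a"
      using dominated_by_times[OF \<rho>(1) b] by blast
    have "\<sigma> = \<rho>"
      using hb by (intro min \<sigma>(1,2) \<sigma>(4)) auto
    then show ?thesis
      using \<sigma>(3)[of a] pm_seminormD(3)[OF \<rho>(1), of a b] by simp
  qed
  have hk: "\<rho> (sqpow k h) = 1" for k
    by (simp add: seminorm_sqpow[OF \<rho>(1)] \<rho>(3))
  have "\<rho> (sqpow k h) \<le> \<rho> (h * sqpow k h)" for k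
  proof (cases k)
    case 0
    then show ?thesis by (simp add: pm_seminormD(4)[OF \<rho>(1)] \<rho>(3))
  next
    case (Suc j)
    \<comment> \<open>Without a unit, \<open>h\<close> can be split off only from powers with
      exponent at least 2, hence \<open>Suc j\<close>; exponent 1 is the case \<open>k = 0\<close>
      above.\<close>
    have fac: "\<exists>c. sqpow (Suc j) h = h * c \<and> \<rho> c \<le> 1" for j
    proof (induction j)
      case 0
      then show ?case by (intro exI[of _ h]) (simp add: \<rho>(3))
    next
      case (Suc j)
      then obtain c where c: "sqpow (Suc j) h = h * c" "\<rho> c \<le> 1" by blast
      have "sqpow (Suc (Suc j)) h = h * (c * sqpow (Suc j) h)"
        using c(1) by (simp add: mult.assoc)
      moreover have "\<rho> (c * sqpow (Suc j) h) \<le> 1"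
        using pm_seminormD(3)[OF \<rho>(1), of c "sqpow (Suc j) h"] c(2) by (simp only: hk)
      ultimately show ?case by blast
    qed
    then obtain c where c: "sqpow k h = h * c" "\<rho> c \<le> 1"
      using Suc by blast
    have "sqpow (Suc k) h = (h * sqpow k h) * c"
      using c(1) commute mult.assoc by (metis sqpow.simps(2))
    then have "1 \<le> \<rho> (h * sqpow k h) * \<rho> c"
      using pm_seminormD(3)[OF \<rho>(1), of "h * sqpow k h" c] hk[of "Suc k"] by simp
    also have "\<dots> \<le> \<rho> (h * sqpow k h)"
      using c(2) seminorm_nonneg[OF \<rho>(1)] by (simp add: mult_left_le)
    finally show ?thesis by (simp add: hk)
  qed
  then have "\<rho> (a * h) = \<rho> a" for a
    using key[of h a] \<rho>(3) by simp
  then have "\<rho> (h * a) = \<rho> a" for a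
    by (simp add: commute[of h])
  then have "\<rho> (a * b) = \<rho> a * \<rho> b" for a b
  proof (cases "\<rho> b > 0")
    case False
    then have "\<rho> b = 0" using seminorm_nonneg[OF \<rho>(1), of b] by simp
    then show ?thesis
      using pm_seminormD(3)[OF \<rho>(1), of a b] seminorm_nonneg[OF \<rho>(1), of "a * b"] by simp
  qed (simp add: key)
  then show thesis using that \<rho> by blast
qed

text \<open>Ostrowski's argument, made homogeneous in \<open>y\<close> and \<open>h\<close> so that no unit is needed: with
  \<open>m\<close> the minimum of \<open>\<rho> (y - l h)\<close> over \<open>l\<close>, factoring \<open>y\<^sup>n - \<mu>\<^sup>n h\<^sup>n\<close> for \<open>n = 2\<^sup>k\<close> shows that \<open>\<rho> (y - \<mu> h) = m\<close>
  on a disc of radius \<open>m\<close> around every minimum point.\<close>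

lemma Gelfand_Mazur_seminorm:
  assumes \<rho>: "pm_seminorm sc \<rho>" and h: "\<rho> h = 1"
    and mult: "\<And>a b. \<rho> (a * b) = \<rho> a * \<rho> b"
  shows "\<exists>l. \<rho> (y - sc l h) = 0"
proof -
  define g where "g y l = \<rho> (y - sc l h)" for y l
  have lip: "\<bar>g y l - g y m\<bar> \<le> cmod (l - m)" for y l m
  proof -
    have "(y - sc l h) - (y - sc m h) = sc (m - l) h"
      using sc_plus[of "m - l" l h] by simp
    then show ?thesis
      using seminorm_reverse[OF \<rho>, of "y - sc l h" "y - sc m h"]
      by (simp add: g_def pm_seminormD(2)[OF \<rho>] h norm_minus_commute)
  qed
  have lower: "cmod l - \<rho> y \<le> g y l" for y l
    using seminorm_diff_le[OF \<rho>, of y "y - sc l h"] by (simp add: g_def pm_seminormD(2)[OF \<rho>] h)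
  have cont: "continuous_on UNIV (g y)" for y
    unfolding continuous_on_iff
    by (metis lip dist_real_def dist_norm le_less_trans)
  \<comment> \<open>Outside this disc \<open>lower\<close> gives more than
    \<open>g y 0 = \<rho> y\<close>, so a minimum on the disc is global.\<close>
  have "\<exists>x\<in>cball 0 (2 * \<rho> y + 1). \<forall>l\<in>cball 0 (2 * \<rho> y + 1). g y x \<le> g y l"
    using seminorm_nonneg[OF \<rho>, of y]
    by (intro continuous_attains_inf continuous_on_subset[OF cont]) auto
  then obtain x where x: "\<And>l. cmod l \<le> 2 * \<rho> y + 1 \<Longrightarrow> g y x \<le> g y l"
    by (metis mem_cball_0)
  define m where "m = g y x"
  have g00: "g y 0 = \<rho> y" by (simp add: g_def sc_zero)
  have min: "m \<le> g y l" for l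
  proof (cases "cmod l \<le> 2 * \<rho> y + 1")
    case False
    then show ?thesis
      using lower[of l y] x[of 0] seminorm_nonneg[OF \<rho>, of y] g00 by (simp add: m_def)
  qed (simp add: m_def x)
  have "m = 0"
  proof (rule ccontr)
    assume "m \<noteq> 0"
    then have m: "m > 0" using seminorm_nonneg[OF \<rho>] by (simp add: m_def g_def order_less_le)
    have shift: "g (y - sc z h) l = g y (z + l)" for z l
      by (simp add: g_def sc_plus diff_diff_eq)
    have step: "g y (z + w) = m" if z: "g y z = m" and w: "cmod w < m" for z w
    proof -
      define v where "v = y - sc z h"
      have vmin: "m \<le> g v l" for l using min shift by (simp add: v_def)
      have v0: "\<rho> v = m" using z by (simp add: v_def g_def)
      \<comment> \<open>The doubling step factors a^2 - t^2 b^2 as (a - t b)(a + t b). The second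
        factor belongs to the point \<open>om * u\<close>, where only the lower bound
        \<open>m\<close> is used.\<close>
      have S: "g v u * m ^ (2 ^ k - 1) \<le> \<rho> (sqpow k v - sc (u ^ 2 ^ k) (sqpow k h))" for k u
      proof (induction k arbitrary: u)
        case 0
        then show ?case by (simp add: g_def)
      next
        case (Suc k)
        obtain om :: complex where om: "om ^ (2 ^ k) = - 1"
        proof -
          have "\<exists>om::complex. om ^ (2 ^ k) = - 1"
          proof (intro exI)
            have "cis (pi / 2 ^ k) ^ 2 ^ k = cis (real (2 ^ k) * (pi / 2 ^ k))"
              by (rule Complex.DeMoivre)
            also have "real (2 ^ k) * (pi / 2 ^ k) = pi" by simp
            finally show "cis (pi / 2 ^ k) ^ 2 ^ k = - 1" by (simp only: cis_pi)
          qed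
          then show thesis using that by blast
        qed
        define a b where "a = sqpow k v" and "b = sqpow k h"
        define t where "t = u ^ 2 ^ k"
        have omt: "(om * u) ^ 2 ^ k = - t" by (simp add: t_def power_mult_distrib om)
        have "sqpow (Suc k) v - sc (u ^ 2 ^ Suc k) (sqpow (Suc k) h) =
            a * a - sc (t * t) (b * b)"
          by (simp add: a_def b_def t_def mult_2 power_add)
        also have "sc (t * t) (b * b) = sc t b * sc t b"
          by (metis sc_mult sc_times sc_times_right)
        also have "a * a - sc t b * sc t b = (a - sc t b) * (a - sc (- t) b)"
          using commute[of "sc t b" a] by (simp add: sc_minus algebra_simps)
        finally have "\<rho> (sqpow (Suc k) v - sc (u ^ 2 ^ Suc k) (sqpow (Suc k) h))
            = \<rho> (a - sc t b) * \<rho> (a - sc (- t) b)"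
          by (simp add: mult)
        moreover have "g v u * m ^ (2 ^ k - 1) \<le> \<rho> (a - sc t b)"
          using Suc.IH[of u] by (simp add: a_def b_def t_def)
        moreover have "m * m ^ (2 ^ k - 1) \<le> \<rho> (a - sc (- t) b)"
        proof -
          have "m * m ^ (2 ^ k - 1) \<le> g v (om * u) * m ^ (2 ^ k - 1)"
            using m vmin by (intro mult_right_mono) auto
          also have "\<dots> \<le> \<rho> (a - sc (- t) b)"
            using Suc.IH[of "om * u"] unfolding omt by (simp add: a_def b_def)
          finally show ?thesis .
        qed
        ultimately have "(g v u * m ^ (2 ^ k - 1)) * (m * m ^ (2 ^ k - 1))
            \<le> \<rho> (sqpow (Suc k) v - sc (u ^ 2 ^ Suc k) (sqpow (Suc k) h))"
          using m by (auto intro!: mult_mono seminorm_nonneg[OF \<rho>])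
        moreover have "m ^ (2 ^ k - 1) * (m * m ^ (2 ^ k - 1)) = m ^ (2 ^ Suc k - 1)"
        proof -
          have "2 ^ k - 1 + Suc (2 ^ k - 1) = (2::nat) ^ Suc k - 1"
            using one_le_power[of "2::nat" k] by simp
          then show ?thesis by (metis power_Suc power_add)
        qed
        ultimately show ?case by (simp add: mult.assoc)
      qed
      have bound: "g v w \<le> m + m * (cmod w / m) ^ 2 ^ k" for k
      proof -
        have "\<rho> (sqpow k v - sc (w ^ 2 ^ k) (sqpow k h)) \<le> m ^ 2 ^ k + cmod w ^ 2 ^ k"
          using seminorm_diff_le[OF \<rho>, of "sqpow k v" "sc (w ^ 2 ^ k) (sqpow k h)"]
          by (simp add: seminorm_sqpow[OF \<rho>] pm_seminormD(2)[OF \<rho>] h v0 norm_power)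
        with S[of w k] have "g v w * m ^ (2 ^ k - 1) \<le> m ^ 2 ^ k + cmod w ^ 2 ^ k" by linarith
        moreover have "m ^ 2 ^ k = m * m ^ (2 ^ k - 1)"
          by (metis power_eq_if power_not_zero zero_neq_numeral)
        ultimately have "g v w * m ^ 2 ^ k \<le> m * (m ^ 2 ^ k + cmod w ^ 2 ^ k)"
          using m mult_left_mono[of "g v w * m ^ (2 ^ k - 1)" "m ^ 2 ^ k + cmod w ^ 2 ^ k" m]
          by (simp add: ac_simps)
        then show ?thesis using m by (simp add: power_divide field_simps)
      qed
      have "(\<lambda>k. m + m * (cmod w / m) ^ 2 ^ k) \<longlonglongrightarrow> m + m * 0"
      proof (intro tendsto_intros)
        have "(\<lambda>n. (cmod w / m) ^ n) \<longlonglongrightarrow> 0"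
          using m w by (intro LIMSEQ_realpow_zero) auto
        moreover have "filterlim (\<lambda>k. 2 ^ k :: nat) sequentially sequentially"
          by (rule filterlim_subseq) (simp add: strict_mono_def)
        ultimately show "(\<lambda>k. (cmod w / m) ^ 2 ^ k) \<longlonglongrightarrow> 0"
          by (rule filterlim_compose)
      qed
      then have "g v w \<le> m"
        using bound by (intro LIMSEQ_le_const[of _ m]) auto
      then show ?thesis using min[of "z + w"] shift[of z w] by (simp add: v_def)
    qed
    \<comment> \<open>Walking along a ray in steps of \<open>m / 2\<close> keeps the value at
      \<open>m\<close>, while \<open>lower\<close> forces growth at infinity.\<close>
    have all: "g y (x + of_real (real n * (m / 2))) = m" for n
    proof (induction n)
      case 0
      then show ?case by (simp add: m_def)
    next
      case (Suc n)
      have "x + of_real (real (Suc n) * (m / 2)) = (x + of_real (real n * (m / 2))) + of_real (m / 2)"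
        by (simp add: algebra_simps add_divide_distrib)
      moreover have "cmod (of_real (m / 2)) < m" using m by simp
      ultimately show ?case using step[OF Suc] by (simp only:)
    qed
    obtain n where n: "real n * (m / 2) > m + \<rho> y + cmod x"
      using ex_less_of_nat_mult[of "m / 2" "m + \<rho> y + cmod x"] m by auto
    have "cmod (x + of_real (real n * (m / 2))) \<ge> real n * (m / 2) - cmod x"
    proof -
      have "real n * (m / 2) = cmod ((x + of_real (real n * (m / 2))) - x)"
        using m by (simp add: norm_mult)
      also have "\<dots> \<le> cmod (x + of_real (real n * (m / 2))) + cmod x"
        by (rule norm_triangle_ineq4)
      finally show ?thesis by simp
    qed
    then show False
      using lower[of "x + of_real (real n * (m / 2))" y] all[of n] n by linarith
  qed
  then show ?thesis unfolding m_def g_def by blast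
qed

text \<open>Modulo the kernel of the multiplicative seminorm \<rho>, every element is a multiple of
  \<open>h\<close>. In the absence of a unit the scalar \<open>\<phi> a\<close> is read off from
  \<open>a * h\<close>, compared with multiples of \<open>h\<close> modulo that kernel; then
  \<open>cmod (\<phi> a) = \<rho> a\<close>.\<close>

theorem character_exists:
  assumes N: "pm_seminorm sc N" and h: "N h = 1"
  obtains \<phi> where "\<And>a b. \<phi> (a + b) = \<phi> a + \<phi> b" "\<And>c a. \<phi> (sc c a) = c * \<phi> a"
    "\<And>a b. \<phi> (a * b) = \<phi> a * \<phi> b" "\<And>a. cmod (\<phi> a) \<le> N a" "cmod (\<phi> h) = 1"
proof -
  obtain \<rho> where \<rho>: "pm_seminorm sc \<rho>" "\<And>a. \<rho> a \<le> N a" "\<rho> h = 1"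
    and mult: "\<And>a b. \<rho> (a * b) = \<rho> a * \<rho> b"
    using multiplicative_seminorm_exists[OF N h] by blast
  have "\<forall>a. \<exists>l. \<rho> (a * h - sc l h) = 0"
    using Gelfand_Mazur_seminorm[OF \<rho>(1,3) mult] by blast
  then obtain \<phi> where \<phi>: "\<And>a. \<rho> (a * h - sc (\<phi> a) h) = 0" by metis
  have uniq: "\<phi> a = l" if "\<rho> (a * h - sc l h) = 0" for a l
  proof -
    have "(a * h - sc l h) - (a * h - sc (\<phi> a) h) = sc (\<phi> a - l) h"
      using sc_plus[of "\<phi> a - l" l h] by (simp add: algebra_simps)
    then have "\<rho> (sc (\<phi> a - l) h) \<le> 0"
      using seminorm_diff_le[OF \<rho>(1), of "a * h - sc l h" "a * h - sc (\<phi> a) h"] that \<phi> by simp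
    then show ?thesis by (simp add: pm_seminormD(2)[OF \<rho>(1)] \<rho>(3))
  qed
  have zero: "\<rho> a = 0" if "\<rho> a \<le> 0" for a
    using that seminorm_nonneg[OF \<rho>(1), of a] by simp
  show thesis
  proof
    fix a b c
    have "(a + b) * h - sc (\<phi> a + \<phi> b) h = (a * h - sc (\<phi> a) h) + (b * h - sc (\<phi> b) h)"
      by (simp add: sc_plus algebra_simps)
    then show "\<phi> (a + b) = \<phi> a + \<phi> b"
      using pm_seminormD(1)[OF \<rho>(1), of "a * h - sc (\<phi> a) h" "b * h - sc (\<phi> b) h"] \<phi>
      by (intro uniq zero) simp
    have "sc c a * h - sc (c * \<phi> a) h = sc c (a * h - sc (\<phi> a) h)"
      by (simp add: sc_diff sc_mult sc_times)
    then show "\<phi> (sc c a) = c * \<phi> a"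
      using \<phi> by (intro uniq) (simp add: pm_seminormD(2)[OF \<rho>(1)])
    \<comment> \<open>A further factor \<open>h\<close>, harmless since \<rho> is multiplicative
      with \<open>\<rho> h = 1\<close>, gives each of \<open>a\<close> and \<open>b\<close> its own
      \<open>h\<close>.\<close>
    have "\<rho> (a * b * h - sc (\<phi> a * \<phi> b) h) = \<rho> ((a * b * h - sc (\<phi> a * \<phi> b) h) * h)"
      by (simp add: mult \<rho>(3))
    also have "(a * b * h - sc (\<phi> a * \<phi> b) h) * h =
        (a * h - sc (\<phi> a) h) * (b * h) + sc (\<phi> a) h * (b * h - sc (\<phi> b) h)"
    proof -
      have "a * b * h * h = a * h * (b * h)" using commute mult.assoc by metis
      moreover have "sc (\<phi> a * \<phi> b) h * h = sc (\<phi> a) h * sc (\<phi> b) h"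
        by (metis sc_mult sc_times sc_times_right)
      ultimately show ?thesis by (simp add: algebra_simps)
    qed
    also have "\<rho> \<dots> \<le> 0"
      using pm_seminormD(1)[OF \<rho>(1), of "(a * h - sc (\<phi> a) h) * (b * h)"
          "sc (\<phi> a) h * (b * h - sc (\<phi> b) h)"] \<phi> by (simp add: mult)
    finally show "\<phi> (a * b) = \<phi> a * \<phi> b"
      by (intro uniq zero)
    have abs: "cmod (\<phi> a) = \<rho> a" for a
      using seminorm_reverse[OF \<rho>(1), of "a * h" "sc (\<phi> a) h"] \<phi>[of a]
      by (simp add: mult \<rho>(3) pm_seminormD(2)[OF \<rho>(1)])
    then show "cmod (\<phi> a) \<le> N a" "cmod (\<phi> h) = 1"
      using \<rho>(2,3) by simp_all
  qed
qed

end

section \<open>Polynomials in a self-adjoint element\<close>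

locale cstar =
  fixes sm :: "complex \<Rightarrow> 'a::{real_normed_algebra,banach} \<Rightarrow> 'a" and st :: "'a \<Rightarrow> 'a"
  assumes sm_real: "sm (complex_of_real r) a = r *\<^sub>R a"
    and sm_add: "sm c (a + b) = sm c a + sm c b"
    and sm_plus: "sm (c + d) a = sm c a + sm d a"
    and sm_mult: "sm (c * d) a = sm c (sm d a)"
    and sm_one: "sm 1 a = a"
    and sm_times_left: "sm c (a * b) = sm c a * b"
    and sm_times_right: "sm c (a * b) = a * sm c b"
    and norm_sm: "norm (sm c a) = cmod c * norm a"
    and st_st: "st (st a) = a"
    and st_add: "st (a + b) = st a + st b"
    and st_sm: "st (sm c a) = sm (cnj c) (st a)"
    and st_times: "st (a * b) = st b * st a"
    and norm_st_times: "norm (st a * a) = (norm a)\<^sup>2"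
begin

section \<open>Scalars, involution and the C*-identity\<close>

lemma sm_zero: "sm 0 a = 0"
  using sm_plus[of 0 0 a] by simp

lemma sm_zero_right: "sm c 0 = 0"
  using sm_add[of c 0 0] by simp

lemma sm_minus_right: "sm c (- a) = - sm c a"
  using sm_add[of c "- a" a] by (simp add: sm_zero_right eq_neg_iff_add_eq_0)

lemma sm_commute: "sm c (sm d a) = sm d (sm c a)"
  by (metis sm_mult mult.commute)

lemma st_zero: "st 0 = 0"
  using st_add[of 0 0] by simp

lemma st_minus: "st (- a) = - st a"
  using st_add[of "- a" a] by (simp add: st_zero eq_neg_iff_add_eq_0)

lemma st_diff: "st (a - b) = st a - st b"
  using st_add[of a "- b"] by (simp add: st_minus)

lemma st_scaleR: "st (r *\<^sub>R a) = r *\<^sub>R st a"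
  using st_sm[of "of_real r" a] by (simp add: sm_real)

lemma norm_le_norm_st: "norm a \<le> norm (st a)"
proof (cases "norm a = 0")
  case False
  have "norm a * norm a \<le> norm (st a) * norm a"
    using norm_mult_ineq[of "st a" a] by (simp add: norm_st_times power2_eq_square)
  with False show ?thesis by simp
qed simp

lemma norm_st: "norm (st a) = norm a"
  using norm_le_norm_st[of a] norm_le_norm_st[of "st a"] by (simp add: st_st)

lemma st_times_self_eq_0: "st a * a = 0 \<longleftrightarrow> a = 0"
  using norm_st_times[of a] by auto

text \<open>Stands in for evaluation at a unit: d = a - b multiplied by d* gives 0, and the
  C*-identity applies to d*.\<close>

lemma eq_if_left_mult_eq:
  fixes a b :: 'a
  assumes *: "\<And>c. a * c = b * c"
  shows "a = b"
proof -
  have "st (st (a - b)) * st (a - b) = 0"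
    using *[of "st (a - b)"] by (simp add: st_st left_diff_distrib)
  then have "st (a - b) = 0" by (simp only: st_times_self_eq_0)
  then have "st (st (a - b)) = 0" by (simp only: st_zero)
  then show "a = b" by (simp add: st_st)
qed

lemma tendsto_st: "X \<longlonglongrightarrow> x \<Longrightarrow> (\<lambda>n. st (X n)) \<longlonglongrightarrow> st x"
  by (simp add: tendsto_iff dist_norm st_diff[symmetric] norm_st)

text \<open>Orthogonality kills both cross terms, so c* c is the same for c = u + v and c = u - v,
  and it determines the norm.\<close>

lemma norm_add_eq_norm_diff:
  assumes "st u * v = 0"
  shows "norm (u + v) = norm (u - v)"
proof -
  have "st v * u = 0"
    using arg_cong[OF assms, of st] by (simp add: st_times st_st st_zero)
  then have "st (u + v) * (u + v) = st (u - v) * (u - v)"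
    using assms by (simp add: st_add st_diff algebra_simps)
  then have "(norm (u + v))\<^sup>2 = (norm (u - v))\<^sup>2"
    by (metis norm_st_times)
  then show ?thesis by simp
qed

text \<open>This is P(H) a. As a unit may be missing, P(H) is treated as a left multiplier whose
  constant term acts by scalars. The fold is Horner's scheme.\<close>

definition act :: "'a \<Rightarrow> complex poly \<Rightarrow> 'a \<Rightarrow> 'a" where
  "act H P a = fold_coeffs (\<lambda>c v. sm c a + H * v) P 0"

lemma act_0 [simp]: "act H 0 a = 0"
  by (simp add: act_def)

lemma act_pCons [simp]: "act H (pCons c P) a = sm c a + H * act H P a"
proof (cases "P = 0 \<and> c = 0")
  case True
  then show ?thesis by (simp add: act_def sm_zero)
next
  case False
  then show ?thesis by (cases "P = 0") (auto simp: act_def)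
qed

lemma act_1 [simp]: "act H 1 a = a"
  by (simp add: one_pCons sm_one)

lemma act_add: "act H (P + Q) a = act H P a + act H Q a"
  by (induction P Q rule: poly_induct2) (simp_all add: sm_plus algebra_simps)

lemma act_smult: "act H (smult c P) a = sm c (act H P a)"
  by (induction P) (simp_all add: sm_zero_right sm_add sm_mult sm_times_right)

lemma act_diff: "act H (P - Q) a = act H P a - act H Q a"
  using act_add[of H "P - Q" Q a] by simp

lemma act_add_right: "act H P (a + b) = act H P a + act H P b"
  by (induction P) (simp_all add: sm_add algebra_simps)

lemma act_sm: "act H P (sm c a) = sm c (act H P a)"
  by (induction P) (simp_all add: sm_zero_right sm_add sm_times_right sm_commute[of c])

lemma act_scaleR: "act H P (r *\<^sub>R a) = r *\<^sub>R act H P a"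
  by (metis act_sm sm_real)

lemma act_times: "act H P (a * b) = act H P a * b"
  by (induction P) (simp_all add: sm_times_left algebra_simps)

lemma act_commute: "x * H = H * x \<Longrightarrow> act H P (x * a) = x * act H P a"
proof (induction P)
  case (pCons c P)
  then have "H * (x * act H P a) = x * (H * act H P a)" by (metis mult.assoc)
  with pCons show ?case by (simp add: sm_times_right algebra_simps)
qed simp

lemma act_mult: "act H (P * Q) a = act H P (act H Q a)"
  by (induction P) (simp_all add: act_add act_smult sm_zero)

lemma act_adjoint:
  assumes H: "st H = H"
  shows "st (act H P a) * b = st a * act H (map_poly cnj P) b"
proof (induction P arbitrary: b)
  case (pCons c P)
  have "st (act H (pCons c P) a) * b = sm (cnj c) (st a) * b + st (act H P a) * (H * b)"
    by (simp add: st_add st_sm st_times H algebra_simps)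
  also have "\<dots> = st a * sm (cnj c) b + st a * act H (map_poly cnj P) (H * b)"
    by (simp add: pCons.IH sm_times_left[symmetric] sm_times_right)
  also have "\<dots> = st a * act H (map_poly cnj (pCons c P)) b"
    by (simp add: map_poly_pCons act_commute algebra_simps)
  finally show ?case .
qed (simp add: st_zero)

section \<open>Operator norms of polynomials in H\<close>

lemma act_bounded_linear: "bounded_linear (act H P)"
proof -
  have "\<exists>B. \<forall>a. norm (act H P a) \<le> norm a * B"
  proof (induction P)
    case (pCons c P)
    then obtain B where B: "\<And>a. norm (act H P a) \<le> norm a * B" by blast
    have "norm (act H (pCons c P) a) \<le> norm a * (cmod c + norm H * B)" for a
    proof -
      have "norm (act H (pCons c P) a) \<le> norm (sm c a) + norm (H * act H P a)"
        by (simp add: norm_triangle_ineq)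
      also have "\<dots> \<le> cmod c * norm a + norm H * (norm a * B)"
        using norm_mult_ineq[of H "act H P a"] mult_left_mono[OF B[of a], of "norm H"]
        by (simp add: norm_sm)
      finally show ?thesis by (simp add: algebra_simps)
    qed
    then show ?case by blast
  qed (auto intro: exI[of _ 0])
  then obtain B where "\<And>a. norm (act H P a) \<le> norm a * B" by blast
  then show ?thesis
    by (intro bounded_linear_intro[of _ B]) (auto simp: act_add_right act_scaleR)
qed

lemma norm_act_le: "norm (act H P a) \<le> onorm (act H P) * norm a"
  by (rule onorm[OF act_bounded_linear])

lemma onorm_act_nonneg: "0 \<le> onorm (act H P)"
  by (rule onorm_pos_le[OF act_bounded_linear])

lemma onorm_act_smult: "onorm (act H (smult c P)) = cmod c * onorm (act H P)"
proof -
  have le: "onorm (act H (smult c P)) \<le> cmod c * onorm (act H P)" for c P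
  proof (rule onorm_bound)
    show "norm (act H (smult c P) a) \<le> cmod c * onorm (act H P) * norm a" for a
      using mult_left_mono[OF norm_act_le[of H P a], of "cmod c"]
      by (simp add: act_smult norm_sm mult.assoc)
  qed (simp add: onorm_act_nonneg)
  show ?thesis
  proof (cases "c = 0")
    case True
    then show ?thesis
      using le[of 0 P] onorm_act_nonneg[of H 0] by simp
  next
    case False
    then have "onorm (act H P) \<le> cmod (inverse c) * onorm (act H (smult c P))"
      using le[of "inverse c" "smult c P"] by simp
    then show ?thesis
      using le[of c P] False by (simp add: norm_divide field_simps)
  qed
qed

lemma map_poly_cnj_mult: "map_poly cnj (P * Q) = map_poly cnj P * map_poly cnj Q"
  by (intro poly_eqI) (simp add: coeff_map_poly coeff_mult)

lemma onorm_act_mult_le: "onorm (act H (P * Q)) \<le> onorm (act H P) * onorm (act H Q)"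
  using onorm_compose[OF act_bounded_linear[of H P] act_bounded_linear[of H Q]]
  by (simp add: act_mult[abs_def] o_def)

text \<open>The C*-identity passes to multipliers: the squared norm of P(H) a is the norm of a* c,
  where c is (conj(P) P)(H) a. The resulting inequality also shows that conjugating \<open>P\<close>
  preserves the norm, and this gives the converse.\<close>

lemma onorm_act_cnj_mult:
  assumes H: "st H = H"
  shows "onorm (act H (map_poly cnj P * P)) = (onorm (act H P))\<^sup>2"
proof -
  have le: "(onorm (act H P))\<^sup>2 \<le> onorm (act H (map_poly cnj P * P))" for P
  proof -
    let ?B = "onorm (act H (map_poly cnj P * P))"
    have "onorm (act H P) \<le> sqrt ?B"
    proof (rule onorm_bound)
      fix a
      have "(norm (act H P a))\<^sup>2 = norm (st a * act H (map_poly cnj P * P) a)"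
        by (metis norm_st_times act_adjoint[OF H] act_mult)
      also have "\<dots> \<le> norm a * (?B * norm a)"
        using norm_mult_ineq[of "st a" "act H (map_poly cnj P * P) a"]
          mult_left_mono[OF norm_act_le[of H "map_poly cnj P * P" a], of "norm a"]
        by (simp add: norm_st)
      finally have "(norm (act H P a))\<^sup>2 \<le> (sqrt ?B * norm a)\<^sup>2"
        by (simp add: power2_eq_square algebra_simps onorm_act_nonneg)
      then show "norm (act H P a) \<le> sqrt ?B * norm a"
        by (rule power2_le_imp_le) (simp add: onorm_act_nonneg)
    qed (simp add: onorm_act_nonneg)
    then show ?thesis
      using power_mono[of "onorm (act H P)" "sqrt ?B" 2] by (simp add: onorm_act_nonneg)
  qed
  have le2: "onorm (act H P) \<le> onorm (act H (map_poly cnj P))" for P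
  proof (cases "onorm (act H P) = 0")
    case False
    have "onorm (act H P) * onorm (act H P) \<le> onorm (act H (map_poly cnj P)) * onorm (act H P)"
      using le[of P] onorm_act_mult_le[of H "map_poly cnj P" P] by (simp add: power2_eq_square)
    then show ?thesis
      using False onorm_act_nonneg[of H P] by simp
  qed (simp add: onorm_act_nonneg)
  have "map_poly cnj (map_poly cnj P) = P"
    by (simp add: map_poly_map_poly o_def)
  then have "onorm (act H (map_poly cnj P)) = onorm (act H P)"
    using le2[of P] le2[of "map_poly cnj P"] by simp
  then show ?thesis
    using le[of P] onorm_act_mult_le[of H "map_poly cnj P" P] by (simp add: power2_eq_square)
qed

text \<open>For squares: S = conj(P) P is its own conjugate, so the C*-identity computes the norm of
  S^2 as the fourth power of the norm of \<open>P\<close>.\<close>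

lemma pm_seminorm_onorm_act:
  assumes H: "st H = H"
  shows "pm_seminorm smult (\<lambda>P. onorm (act H P))"
proof (rule pm_seminormI)
  fix P Q :: "complex poly" and c
  show "onorm (act H (P + Q)) \<le> onorm (act H P) + onorm (act H Q)"
    using onorm_triangle[OF act_bounded_linear[of H P] act_bounded_linear[of H Q]]
    by (simp add: act_add[abs_def])
  let ?S = "map_poly cnj P * P"
  have S: "map_poly cnj ?S = ?S"
    by (simp add: map_poly_cnj_mult map_poly_map_poly o_def mult.commute)
  have "(onorm (act H (P * P)))\<^sup>2 = onorm (act H (?S * ?S))"
    by (simp only: onorm_act_cnj_mult[OF H, symmetric] map_poly_cnj_mult ac_simps)
  also have "\<dots> = ((onorm (act H P))\<^sup>2)\<^sup>2"
    using onorm_act_cnj_mult[OF H, of ?S] by (simp only: S onorm_act_cnj_mult[OF H])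
  finally show "onorm (act H (P * P)) = (onorm (act H P))\<^sup>2"
    by (metis onorm_act_nonneg power2_eq_iff_nonneg zero_le_power2)
qed (rule onorm_act_smult onorm_act_mult_le)+

lemma comm_complex_algebra_smult: "comm_complex_algebra (smult :: complex \<Rightarrow> _)"
  by unfold_locales (simp_all add: smult_add_right smult_add_left mult.commute)

text \<open>A character of the polynomial ring that is dominated by the operator norm and attains it
  at \<open>P\<close> is evaluation at a point z. The C*-identity makes z real with modulus at most
  \<open>norm H\<close>.\<close>

lemma norm_act_le_sup:
  assumes H: "st H = H"
    and B: "\<And>t. \<bar>t\<bar> \<le> norm H \<Longrightarrow> cmod (poly P (of_real t)) \<le> B"
  shows "norm (act H P a) \<le> B * norm a"
proof (cases "onorm (act H P) = 0")
  case True
  have "0 \<le> B" using order_trans[OF norm_ge_zero B[of 0]] by simp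
  with True show ?thesis
    using norm_act_le[of H P a] by (auto intro: order_trans mult_nonneg_nonneg)
next
  case False
  let ?N = "onorm (act H P)" and ?X = "[:0, 1:] :: complex poly"
  interpret comm_complex_algebra "smult :: complex \<Rightarrow> _" by (rule comm_complex_algebra_smult)
  define h where "h = smult (of_real (inverse ?N)) P"
  have "onorm (act H h) = 1"
    using False onorm_act_nonneg[of H P] by (simp add: h_def onorm_act_smult norm_inverse)
  then obtain \<phi> where \<phi>: "\<And>P Q. \<phi> (P + Q) = \<phi> P + \<phi> Q" "\<And>c P. \<phi> (smult c P) = c * \<phi> P"
    "\<And>P Q. \<phi> (P * Q) = \<phi> P * \<phi> Q" "\<And>P. cmod (\<phi> P) \<le> onorm (act H P)" "cmod (\<phi> h) = 1"
    using character_exists[OF pm_seminorm_onorm_act[OF H]] by blast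
  have one: "\<phi> 1 = 1"
    using \<phi>(3)[of 1 h] \<phi>(5) by auto
  define z where "z = \<phi> ?X"
  have eval: "\<phi> Q = poly Q z" for Q
  proof (induction Q)
    case 0
    then show ?case using \<phi>(2)[of 0 0] by simp
  next
    case (pCons c Q)
    have "pCons c Q = smult c 1 + ?X * Q" by (simp add: one_pCons)
    then show ?case using pCons.IH by (simp only: \<phi> one z_def[symmetric]) simp
  qed
  have X: "norm (act H ?X a) \<le> norm H * norm a" for a
    by (simp add: sm_zero sm_one norm_mult_ineq)
  \<comment> \<open>Arens's trick: the squared norm of X + i s is at most s^2 plus the square of
    \<open>norm H\<close>, so \<open>2 * Im z * s\<close> stays bounded above for all real
    \<open>s\<close>.\<close>
  have "(Re z)\<^sup>2 + (Im z + s)\<^sup>2 \<le> (norm H)\<^sup>2 + s\<^sup>2" for s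
  proof -
    let ?P = "[:\<i> * of_real s, 1:] :: complex poly"
    have "map_poly cnj ?P * ?P = smult (of_real (s\<^sup>2)) 1 + ?X * ?X"
      by (simp add: map_poly_pCons one_pCons power2_eq_square complex_eq_iff)
    moreover have "onorm (act H (smult (of_real (s\<^sup>2)) 1 + ?X * ?X)) \<le> s\<^sup>2 + (norm H)\<^sup>2"
    proof (rule onorm_bound)
      fix a
      have "norm (act H (?X * ?X) a) \<le> norm H * (norm H * norm a)"
        unfolding act_mult by (rule order_trans[OF X mult_left_mono[OF X]]) simp
      then show "norm (act H (smult (of_real (s\<^sup>2)) 1 + ?X * ?X) a) \<le> (s\<^sup>2 + (norm H)\<^sup>2) * norm a"
        using norm_triangle_ineq[of "act H (smult (of_real (s\<^sup>2)) 1) a" "act H (?X * ?X) a"]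
        by (simp only: act_add act_smult act_1 norm_sm)
          (simp add: algebra_simps power2_eq_square norm_mult)
    qed simp
    ultimately have "(onorm (act H ?P))\<^sup>2 \<le> s\<^sup>2 + (norm H)\<^sup>2"
      using onorm_act_cnj_mult[OF H, of ?P] by simp
    moreover have "(cmod (poly ?P z))\<^sup>2 \<le> (onorm (act H ?P))\<^sup>2"
      using \<phi>(4)[of ?P] by (intro power_mono) (simp_all only: eval norm_ge_zero)
    moreover have "(cmod (poly ?P z))\<^sup>2 = (Re z)\<^sup>2 + (Im z + s)\<^sup>2"
      by (simp add: cmod_power2 add.commute)
    ultimately show ?thesis by linarith
  qed
  note zs = this
  have "Im z = 0"
  proof (rule ccontr)
    assume im: "Im z \<noteq> 0"
    define s where "s = ((norm H)\<^sup>2 + 1) / (2 * Im z)"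
    have "2 * Im z * s = (norm H)\<^sup>2 + 1" using im by (simp add: s_def)
    then show False
      using zs[of s] zero_le_power2[of "Re z"] zero_le_power2[of "Im z"]
      unfolding power2_sum by linarith
  qed
  then have z: "z = of_real (Re z)" by (simp add: complex_eq_iff)
  have "\<bar>Re z\<bar> \<le> norm H"
    using zs[of 0] \<open>Im z = 0\<close> by (simp add: abs_le_square_iff[symmetric])
  from B[OF this] have "cmod (poly P z) \<le> B" by (subst z)
  moreover have "poly P z = of_real ?N * poly h z" using False by (simp add: h_def)
  then have "cmod (poly P z) = ?N"
    using \<phi>(5) by (simp add: eval norm_mult onorm_act_nonneg)
  ultimately have "?N \<le> B" by simp
  then show ?thesis
    using norm_act_le[of H P a] mult_right_mono[of ?N B "norm a"] by simp
qed

lemma act_pcompose_square: "act (s * s) P a = act s (pcompose P [:0, 0, 1:]) a"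
  by (induction P) (simp_all add: pcompose_pCons act_add act_mult sm_zero sm_one mult.assoc)

end

section \<open>Continuous functional calculus\<close>

text \<open>The interval plays the role of a set containing the spectrum, through the sup-norm
  estimate alone. Besides the symmetric interval it will be one starting at 0, for squares; this is
  how positivity enters.\<close>

locale functional_calculus = cstar sm st
  for sm :: "complex \<Rightarrow> 'a::{real_normed_algebra,banach} \<Rightarrow> 'a" and st +
  fixes H :: 'a and \<alpha> \<beta> :: real
  assumes self_adjoint: "st H = H"
    and norm_act_bound: "\<And>P B a. (\<And>t. t \<in> {\<alpha>..\<beta>} \<Longrightarrow> cmod (poly P (of_real t)) \<le> B)
      \<Longrightarrow> norm (act H P a) \<le> B * norm a"
begin

definition approx :: "(nat \<Rightarrow> complex poly) \<Rightarrow> (real \<Rightarrow> real) \<Rightarrow> bool" where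
  "approx P f \<longleftrightarrow> uniform_limit {\<alpha>..\<beta>} (\<lambda>n t. poly (P n) (of_real t)) (\<lambda>t. of_real (f t)) sequentially"

lemma approx_exists:
  assumes "continuous_on {\<alpha>..\<beta>} f"
  shows "\<exists>P. approx P f"
proof -
  have "\<exists>P. \<forall>t\<in>{\<alpha>..\<beta>}. cmod (poly P (of_real t) - of_real (f t)) < inverse (real (Suc n))" for n
  proof -
    obtain g where g: "real_polynomial_function g" "\<And>t. t \<in> {\<alpha>..\<beta>} \<Longrightarrow> \<bar>f t - g t\<bar> < inverse (real (Suc n))"
      using Stone_Weierstrass_real_polynomial_function[OF _ assms, of "inverse (real (Suc n))"] by auto
    obtain c m where c: "g = (\<lambda>t. \<Sum>i\<le>m. c i * t ^ i)"
      using g(1) unfolding real_polynomial_function_iff_sum by blast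
    define P where "P = (\<Sum>i\<le>m. monom (complex_of_real (c i)) i)"
    have "poly P (of_real t) = of_real (g t)" for t
      by (simp add: P_def c poly_sum poly_monom)
    then have "cmod (poly P (of_real t) - of_real (f t)) = \<bar>f t - g t\<bar>" for t
      by (metis abs_minus_commute norm_of_real of_real_diff)
    then show ?thesis using g(2) by (intro exI[of _ P]) simp
  qed
  then obtain P where P: "\<And>n t. t \<in> {\<alpha>..\<beta>} \<Longrightarrow>
      cmod (poly (P n) (of_real t) - of_real (f t)) < inverse (real (Suc n))"
    by metis
  have "approx P f"
    unfolding approx_def
  proof (rule uniform_limitI)
    fix e :: real assume "e > 0"
    then have "\<forall>\<^sub>F n in sequentially. inverse (real (Suc n)) < e"
      using LIMSEQ_inverse_real_of_nat by (simp add: order_tendsto_iff)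
    then show "\<forall>\<^sub>F n in sequentially. \<forall>t\<in>{\<alpha>..\<beta>}. dist (poly (P n) (of_real t)) (of_real (f t)) < e"
      by eventually_elim (auto simp: dist_norm intro: less_trans[OF P])
  qed
  then show ?thesis by blast
qed

lemma approx_Cauchy:
  assumes "approx P f" "approx Q f" "e > 0"
  obtains N where "\<And>m n. m \<ge> N \<Longrightarrow> n \<ge> N \<Longrightarrow> norm (act H (P m) a - act H (Q n) a) \<le> e * norm a"
proof -
  obtain N1 where N1: "\<And>n t. n \<ge> N1 \<Longrightarrow> t \<in> {\<alpha>..\<beta>} \<Longrightarrow> dist (poly (P n) (of_real t)) (of_real (f t)) < e / 2"
    using assms(1,3) unfolding approx_def uniform_limit_sequentially_iff by (meson half_gt_zero)
  obtain N2 where N2: "\<And>n t. n \<ge> N2 \<Longrightarrow> t \<in> {\<alpha>..\<beta>} \<Longrightarrow> dist (poly (Q n) (of_real t)) (of_real (f t)) < e / 2"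
    using assms(2,3) unfolding approx_def uniform_limit_sequentially_iff by (meson half_gt_zero)
  show thesis
  proof
    fix m n assume mn: "m \<ge> max N1 N2" "n \<ge> max N1 N2"
    have "norm (act H (P m - Q n) a) \<le> e * norm a"
    proof (rule norm_act_bound)
      fix t assume "t \<in> {\<alpha>..\<beta>}"
      then show "cmod (poly (P m - Q n) (of_real t)) \<le> e"
        using dist_triangle_half_l[OF N1 N2, of m t n] mn by (simp add: dist_norm)
    qed
    then show "norm (act H (P m) a - act H (Q n) a) \<le> e * norm a"
      by (simp add: act_diff)
  qed
qed

text \<open>f(H) a, again with f(H) as a left multiplier. The choice by \<open>SOME\<close> is
  immaterial: by \<open>fc_LIMSEQ\<close> every approximating sequence has the same limit.\<close>

definition fc :: "(real \<Rightarrow> real) \<Rightarrow> 'a \<Rightarrow> 'a" where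
  "fc f a = lim (\<lambda>n. act H ((SOME P. approx P f) n) a)"

lemma fc_LIMSEQ:
  assumes P: "approx P f"
  shows "(\<lambda>n. act H (P n) a) \<longlonglongrightarrow> fc f a"
proof -
  define Q where "Q = (SOME P. approx P f)"
  have Q: "approx Q f" unfolding Q_def using P by (metis someI)
  have scale: "\<exists>d>0. d * norm a < e" if "e > 0" for e :: real
    using that by (intro exI[of _ "e / (norm a + 1)"])
      (auto simp: field_simps add_pos_nonneg intro: add_strict_increasing)
  have "Cauchy (\<lambda>n. act H (Q n) a)"
  proof (rule CauchyI)
    fix e :: real assume "e > 0"
    then obtain d where "d > 0" "d * norm a < e" using scale by blast
    moreover obtain N where "\<And>m n. m \<ge> N \<Longrightarrow> n \<ge> N \<Longrightarrow> norm (act H (Q m) a - act H (Q n) a) \<le> d * norm a"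
      using approx_Cauchy[OF Q Q \<open>d > 0\<close>] by blast
    ultimately show "\<exists>M. \<forall>m\<ge>M. \<forall>n\<ge>M. norm (act H (Q m) a - act H (Q n) a) < e"
      by (meson le_less_trans)
  qed
  then have lim: "(\<lambda>n. act H (Q n) a) \<longlonglongrightarrow> fc f a"
    by (simp add: fc_def Q_def Cauchy_convergent_iff convergent_LIMSEQ_iff)
  have "(\<lambda>n. act H (P n) a - act H (Q n) a) \<longlonglongrightarrow> 0"
  proof (rule LIMSEQ_I)
    fix e :: real assume "e > 0"
    then obtain d where "d > 0" "d * norm a < e" using scale by blast
    moreover obtain N where "\<And>m n. m \<ge> N \<Longrightarrow> n \<ge> N \<Longrightarrow> norm (act H (P m) a - act H (Q n) a) \<le> d * norm a"
      using approx_Cauchy[OF P Q \<open>d > 0\<close>] by blast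
    ultimately show "\<exists>M. \<forall>n\<ge>M. norm (act H (P n) a - act H (Q n) a - 0) < e"
      by (metis diff_zero le_less_trans)
  qed
  then show ?thesis
    using tendsto_add[OF _ lim] by fastforce
qed

lemma fc_eqI:
  assumes "approx P f" "(\<lambda>n. act H (P n) a) \<longlonglongrightarrow> b"
  shows "fc f a = b"
  using LIMSEQ_unique[OF fc_LIMSEQ[OF assms(1)] assms(2)] .

lemma fc_id: "fc (\<lambda>t. t) a = H * a"
  by (rule fc_eqI[of "\<lambda>n. [:0, 1:]"]) (simp_all add: approx_def sm_zero sm_one uniform_limit_const)

lemma fc_const: "fc (\<lambda>t. c) a = c *\<^sub>R a"
  by (rule fc_eqI[of "\<lambda>n. [:of_real c:]"]) (simp_all add: approx_def sm_real uniform_limit_const)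

context
  fixes f :: "real \<Rightarrow> real"
  assumes f: "continuous_on {\<alpha>..\<beta>} f"
begin

lemma fc_add_right: "fc f (a + b) = fc f a + fc f b"
proof -
  obtain P where P: "approx P f" using approx_exists[OF f] by blast
  show ?thesis
    using tendsto_add[OF fc_LIMSEQ[OF P] fc_LIMSEQ[OF P]] by (intro fc_eqI[OF P]) (simp add: act_add_right)
qed

lemma fc_zero_right: "fc f 0 = 0"
  using fc_add_right[of 0 0] by simp

lemma fc_times: "fc f (a * b) = fc f a * b"
proof -
  obtain P where P: "approx P f" using approx_exists[OF f] by blast
  show ?thesis
    using tendsto_mult_right[OF fc_LIMSEQ[OF P]] by (intro fc_eqI[OF P]) (simp add: act_times)
qed

lemma fc_commute:
  assumes "x * H = H * x"
  shows "fc f (x * a) = x * fc f a"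
proof -
  obtain P where P: "approx P f" using approx_exists[OF f] by blast
  show ?thesis
    using tendsto_mult_left[OF fc_LIMSEQ[OF P]]
    by (intro fc_eqI[OF P]) (simp add: act_commute[OF assms])
qed

lemma fc_adjoint: "st (fc f a) * b = st a * fc f b"
proof -
  obtain P where P: "approx P f" using approx_exists[OF f] by blast
  have P': "approx (\<lambda>n. map_poly cnj (P n)) f"
  proof -
    have "dist (poly (map_poly cnj (P n)) (of_real t)) (complex_of_real (f t)) =
        dist (poly (P n) (of_real t)) (of_real (f t))" for n t
    proof -
      have "poly (map_poly cnj (P n)) (of_real t) - of_real (f t) = cnj (poly (P n) (of_real t) - of_real (f t))"
        using poly_cnj[of "P n" "of_real t"] by simp
      then show ?thesis by (simp only: dist_norm complex_mod_cnj)
    qed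
    then show ?thesis using P by (simp add: approx_def uniform_limit_sequentially_iff)
  qed
  have "(\<lambda>n. st (act H (P n) a) * b) \<longlonglongrightarrow> st (fc f a) * b"
    by (intro tendsto_mult_right tendsto_st fc_LIMSEQ[OF P])
  moreover have "(\<lambda>n. st (act H (P n) a) * b) \<longlonglongrightarrow> st a * fc f b"
    unfolding act_adjoint[OF self_adjoint] by (intro tendsto_mult_left fc_LIMSEQ[OF P'])
  ultimately show ?thesis by (rule LIMSEQ_unique)
qed

lemma approx_eventually_le:
  assumes P: "approx P f" and B: "\<And>t. t \<in> {\<alpha>..\<beta>} \<Longrightarrow> \<bar>f t\<bar> \<le> B" and e: "e > 0"
  shows "\<forall>\<^sub>F n in sequentially. \<forall>a. norm (act H (P n) a) \<le> (B + e) * norm a"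
proof -
  have "\<forall>\<^sub>F n in sequentially. \<forall>t\<in>{\<alpha>..\<beta>}. dist (poly (P n) (of_real t)) (of_real (f t)) < e"
    using P e unfolding approx_def uniform_limit_iff by blast
  then show ?thesis
  proof eventually_elim
    case (elim n)
    have "norm (act H (P n) a) \<le> (B + e) * norm a" for a
    proof (rule norm_act_bound)
      fix t assume t: "t \<in> {\<alpha>..\<beta>}"
      have "cmod (poly (P n) (of_real t)) \<le> cmod (poly (P n) (of_real t) - of_real (f t)) + cmod (of_real (f t))"
        using norm_triangle_ineq[of "poly (P n) (of_real t) - of_real (f t)" "of_real (f t)"] by simp
      then show "cmod (poly (P n) (of_real t)) \<le> B + e"
        using elim t B[OF t] by (force simp: dist_norm)
    qed
    then show ?case by blast
  qed
qed

lemma norm_fc_le: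
  assumes B: "\<And>t. t \<in> {\<alpha>..\<beta>} \<Longrightarrow> \<bar>f t\<bar> \<le> B"
  shows "norm (fc f a) \<le> B * norm a"
proof (rule field_le_epsilon)
  fix e :: real assume e: "e > 0"
  obtain P where P: "approx P f" using approx_exists[OF f] by blast
  define d where "d = e / (norm a + 1)"
  have d: "d > 0" "d * norm a \<le> e"
    using e by (auto simp: d_def field_simps add_pos_nonneg)
  have "\<forall>\<^sub>F n in sequentially. norm (act H (P n) a) \<le> (B + d) * norm a"
    using approx_eventually_le[OF P B d(1)] by (auto elim: eventually_mono)
  then have "norm (fc f a) \<le> (B + d) * norm a"
    by (intro tendsto_upperbound[OF tendsto_norm[OF fc_LIMSEQ[OF P]]]) auto
  then show "norm (fc f a) \<le> B * norm a + e"
    using d(2) by (simp add: algebra_simps)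
qed

text \<open>The multipliers \<open>act H (P n)\<close> are eventually uniformly bounded, so
  polynomial and argument may move together, as the rule for products of functions requires.\<close>

lemma fc_LIMSEQ_arg:
  assumes P: "approx P f" and X: "X \<longlonglongrightarrow> x"
  shows "(\<lambda>n. act H (P n) (X n)) \<longlonglongrightarrow> fc f x"
proof -
  have "bounded (f ` {\<alpha>..\<beta>})"
    by (intro compact_imp_bounded compact_continuous_image f compact_Icc)
  then obtain B where B: "\<And>t. t \<in> {\<alpha>..\<beta>} \<Longrightarrow> \<bar>f t\<bar> \<le> B"
    by (metis bounded_iff imageI real_norm_def)
  have "(\<lambda>n. act H (P n) (X n - x)) \<longlonglongrightarrow> 0"
  proof (rule Lim_null_comparison)
    show "\<forall>\<^sub>F n in sequentially. norm (act H (P n) (X n - x)) \<le> (B + 1) * norm (X n - x)"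
      using approx_eventually_le[OF P B, of 1] by (auto elim: eventually_mono)
    show "(\<lambda>n. (B + 1) * norm (X n - x)) \<longlonglongrightarrow> 0"
      using X by (intro tendsto_mult_right_zero tendsto_norm_zero) (simp add: LIM_zero)
  qed
  from tendsto_add[OF this fc_LIMSEQ[OF P, of x]] show ?thesis
    by (simp add: act_add_right[symmetric])
qed

end

context
  fixes f g :: "real \<Rightarrow> real"
  assumes f: "continuous_on {\<alpha>..\<beta>} f" and g: "continuous_on {\<alpha>..\<beta>} g"
begin

lemma fc_add: "fc (\<lambda>t. f t + g t) a = fc f a + fc g a"
proof -
  obtain P Q where PQ: "approx P f" "approx Q g" using approx_exists f g by meson
  have A: "approx (\<lambda>n. P n + Q n) (\<lambda>t. f t + g t)"
    using uniform_limit_add[OF PQ[unfolded approx_def]] by (simp add: approx_def)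
  show ?thesis
    using tendsto_add[OF fc_LIMSEQ[OF PQ(1), of a] fc_LIMSEQ[OF PQ(2), of a]]
    by (intro fc_eqI[OF A]) (simp_all add: act_add)
qed

lemma fc_mult: "fc (\<lambda>t. f t * g t) a = fc f (fc g a)"
proof -
  obtain P Q where PQ: "approx P f" "approx Q g" using approx_exists f g by meson
  have "bounded ((\<lambda>t. complex_of_real (h t)) ` {\<alpha>..\<beta>})" if "continuous_on {\<alpha>..\<beta>} h" for h
    by (intro compact_imp_bounded compact_continuous_image compact_Icc continuous_intros that)
  then have A: "approx (\<lambda>n. P n * Q n) (\<lambda>t. f t * g t)"
    using uniform_lim_mult[OF PQ[unfolded approx_def]] f g by (simp add: approx_def)
  show ?thesis
    using fc_LIMSEQ_arg[OF f PQ(1) fc_LIMSEQ[OF PQ(2)]]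
    by (intro fc_eqI[OF A]) (simp_all add: act_mult)
qed

lemma fc_diff: "fc (\<lambda>t. f t - g t) a = fc f a - fc g a"
proof -
  obtain P Q where PQ: "approx P f" "approx Q g" using approx_exists f g by meson
  have A: "approx (\<lambda>n. P n - Q n) (\<lambda>t. f t - g t)"
    using uniform_limit_minus[OF PQ[unfolded approx_def]] by (simp add: approx_def)
  show ?thesis
    using tendsto_diff[OF fc_LIMSEQ[OF PQ(1), of a] fc_LIMSEQ[OF PQ(2), of a]]
    by (intro fc_eqI[OF A]) (simp_all add: act_diff)
qed

end

end

section \<open>The calculus for self-adjoint elements and for their squares\<close>

context cstar
begin

lemma functional_calculus_self_adjoint:
  assumes "st H = H"
  shows "functional_calculus sm st H (- norm H) (norm H)"
  using assms norm_act_le_sup[OF assms] by unfold_locales (auto simp: abs_le_iff)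

text \<open>A polynomial in s^2 is an even polynomial in s, and squaring maps the symmetric interval
  into \<open>{0..(norm s)\<^sup>2}\<close>.\<close>

lemma functional_calculus_square:
  assumes s: "st s = s"
  shows "functional_calculus sm st (s * s) 0 ((norm s)\<^sup>2)"
proof unfold_locales
  show "st (s * s) = s * s" by (simp add: st_times s)
  fix P B a assume B: "\<And>t. t \<in> {0..(norm s)\<^sup>2} \<Longrightarrow> cmod (poly P (of_real t)) \<le> B"
  have "norm (act s (pcompose P [:0, 0, 1:]) a) \<le> B * norm a"
  proof (rule norm_act_le_sup[OF s])
    fix t :: real assume "\<bar>t\<bar> \<le> norm s"
    then have "t\<^sup>2 \<le> (norm s)\<^sup>2" by (simp add: abs_le_square_iff[symmetric])
    then show "cmod (poly (pcompose P [:0, 0, 1:]) (of_real t)) \<le> B"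
      using B[of "t\<^sup>2"] by (simp add: poly_pcompose power2_eq_square)
  qed
  then show "norm (act (s * s) P a) \<le> B * norm a" by (simp add: act_pcompose_square)
qed

end

section \<open>Nilpotent elements and commutativity\<close>

context functional_calculus
begin

text \<open>The right multiplication b f(H), obtained from the left one through the
  involution.\<close>

definition rfc :: "(real \<Rightarrow> real) \<Rightarrow> 'a \<Rightarrow> 'a" where
  "rfc f b = st (fc f (st b))"

context
  fixes f :: "real \<Rightarrow> real"
  assumes f: "continuous_on {\<alpha>..\<beta>} f"
begin

lemma rfc_times: "rfc f b * c = b * fc f c"
  by (simp add: rfc_def fc_adjoint[OF f] st_st)

lemma times_rfc: "x * rfc f y = rfc f (x * y)"
  by (simp add: rfc_def st_times fc_times[OF f] st_st)

lemma fc_rfc: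
  assumes "continuous_on {\<alpha>..\<beta>} g"
  shows "fc g (rfc f b) = rfc f (fc g b)"
  by (rule eq_if_left_mult_eq) (metis assms rfc_times fc_times)

lemma norm_rfc_le:
  assumes "\<And>t. t \<in> {\<alpha>..\<beta>} \<Longrightarrow> \<bar>f t\<bar> \<le> B"
  shows "norm (rfc f b) \<le> B * norm b"
  using norm_fc_le[OF f assms, of "st b"] by (simp add: rfc_def norm_st)

lemma st_fc:
  assumes "y * H = H * y"
  shows "st (fc f y) = fc f (st y)"
proof (rule eq_if_left_mult_eq)
  fix c
  have "st y * H = H * st y"
    using arg_cong[OF assms, of st] by (simp add: st_times self_adjoint)
  then show "st (fc f y) * c = fc f (st y) * c"
    by (simp add: fc_adjoint[OF f] fc_times[OF f, symmetric] fc_commute[OF f])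
qed

end

definition commutator :: "(real \<Rightarrow> real) \<Rightarrow> 'a \<Rightarrow> 'a" where
  "commutator f b = fc f b - rfc f b"

context
  assumes reduced: "\<And>x::'a. x * x = 0 \<Longrightarrow> x = 0"
begin

context
  fixes p q :: "real \<Rightarrow> real"
  assumes p: "continuous_on {\<alpha>..\<beta>} p" and q: "continuous_on {\<alpha>..\<beta>} q"
    and pq: "\<And>t. p t * q t = 0"
begin

lemma fc_fc_eq_0: "fc p (fc q b) = 0"
  using fc_mult[OF p q, of b] pq fc_const[of 0 b] by simp

text \<open>The square of p(H) b q(H) has q(H) p(H) = 0 in its middle.\<close>

lemma fc_rfc_eq_0: "fc p (rfc q b) = 0"
proof (rule reduced)
  have "fc q (fc p (rfc q b)) = fc (\<lambda>t. p t * q t) (rfc q b)"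
    using fc_mult[OF q p] by (simp add: mult.commute)
  also have "\<dots> = 0" unfolding pq by (simp add: fc_const)
  finally show "fc p (rfc q b) * fc p (rfc q b) = 0"
    by (simp add: fc_times[OF p, symmetric] rfc_times[OF q] fc_zero_right[OF p])
qed

text \<open>Each of the four terms of [p, b]* [q, b] contains p(H) q(H), or p(H) c q(H) with c one
  of b, b*, b* b.\<close>

lemma norm_commutator_add: "norm (commutator p b + commutator q b) = norm (commutator p b - commutator q b)"
proof (rule norm_add_eq_norm_diff)
  have 1: "st (fc p b) * fc q b = 0"
    by (simp add: fc_adjoint[OF p] fc_fc_eq_0)
  have 2: "st (fc p b) * rfc q b = 0"
    by (simp add: fc_adjoint[OF p] fc_rfc_eq_0)
  have 3: "st (rfc p b) * fc q b = 0"
  proof -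
    have "fc p (st b) * fc q b = fc p (rfc q (st b) * b)"
      by (simp add: fc_times[OF p, symmetric] rfc_times[OF q])
    then show ?thesis
      by (simp add: rfc_def[of p] st_st fc_times[OF p] fc_rfc_eq_0)
  qed
  have 4: "st (rfc p b) * rfc q b = 0"
    by (simp add: rfc_def[of p] st_st fc_times[OF p, symmetric] times_rfc[OF q] fc_rfc[OF q p, symmetric]
        fc_rfc_eq_0)
  show "st (commutator p b) * commutator q b = 0"
    using 1 2 3 4 by (simp add: commutator_def st_diff algebra_simps)
qed

end

lemma norm_commutator_abs:
  assumes f: "continuous_on {\<alpha>..\<beta>} f"
  shows "norm (commutator (\<lambda>t. \<bar>f t\<bar>) b) = norm (commutator f b)"
proof -
  define p q where "p t = max (f t) 0" and "q t = max (- f t) 0" for t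
  have cp: "continuous_on {\<alpha>..\<beta>} p" and cq: "continuous_on {\<alpha>..\<beta>} q"
    unfolding p_def q_def by (intro continuous_intros f)+
  have pq: "p t * q t = 0" for t by (simp add: p_def q_def max_def)
  have "(\<lambda>t. \<bar>f t\<bar>) = (\<lambda>t. p t + q t)" "f = (\<lambda>t. p t - q t)"
    by (auto simp: p_def q_def)
  then have "commutator (\<lambda>t. \<bar>f t\<bar>) b = commutator p b + commutator q b"
    "commutator f b = commutator p b - commutator q b"
    by (simp_all add: commutator_def rfc_def fc_add[OF cp cq] fc_diff[OF cp cq] st_add st_diff)
  then show ?thesis using norm_commutator_add[OF cp cq pq] by simp
qed

lemma commutator_const: "commutator (\<lambda>t. c) b = 0"
  by (simp add: commutator_def rfc_def fc_const st_scaleR st_st)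

lemma commutator_diff_const:
  assumes f: "continuous_on {\<alpha>..\<beta>} f"
  shows "commutator (\<lambda>t. f t - c) b = commutator f b"
  using commutator_const[of c b]
  by (simp add: commutator_def rfc_def fc_diff[OF f continuous_on_const] st_diff)

lemma H_central: "H * b = b * H"
proof -
  define M where "M = max \<bar>\<alpha>\<bar> \<bar>\<beta>\<bar>"
  \<comment> \<open>The values of \<open>\<bar>f t\<bar>\<close> lie between 0 and M / 2^n;
    subtracting the midpoint halves the bound, and constants commute with \<open>b\<close>.\<close>
  have fold: "\<exists>f. continuous_on {\<alpha>..\<beta>} f \<and> (\<forall>t\<in>{\<alpha>..\<beta>}. \<bar>f t\<bar> \<le> M / 2 ^ n) \<and>
      norm (commutator f b) = norm (commutator (\<lambda>t. t) b)" for n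
  proof (induction n)
    case 0
    show ?case
      by (rule exI[of _ "\<lambda>t. t"]) (auto simp: M_def)
  next
    case (Suc n)
    then obtain f where f: "continuous_on {\<alpha>..\<beta>} f" "\<And>t. t \<in> {\<alpha>..\<beta>} \<Longrightarrow> \<bar>f t\<bar> \<le> M / 2 ^ n"
      "norm (commutator f b) = norm (commutator (\<lambda>t. t) b)" by blast
    let ?g = "\<lambda>t. \<bar>f t\<bar> - M / 2 ^ Suc n"
    have c: "continuous_on {\<alpha>..\<beta>} (\<lambda>t. \<bar>f t\<bar>)" by (intro continuous_intros f)
    have "M / 2 ^ n = M / 2 ^ Suc n + M / 2 ^ Suc n" by simp
    then have "\<bar>?g t\<bar> \<le> M / 2 ^ Suc n" if "t \<in> {\<alpha>..\<beta>}" for t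
      using f(2)[OF that] by linarith
    moreover have "norm (commutator ?g b) = norm (commutator (\<lambda>t. t) b)"
      using f(3) by (simp only: commutator_diff_const[OF c] norm_commutator_abs[OF f(1)])
    moreover have "continuous_on {\<alpha>..\<beta>} ?g" by (intro continuous_intros f)
    ultimately show ?case by blast
  qed
  have "norm (commutator (\<lambda>t. t) b) \<le> M / 2 ^ n * norm b + M / 2 ^ n * norm b" for n
  proof -
    obtain f where f: "continuous_on {\<alpha>..\<beta>} f" "\<And>t. t \<in> {\<alpha>..\<beta>} \<Longrightarrow> \<bar>f t\<bar> \<le> M / 2 ^ n"
      "norm (commutator f b) = norm (commutator (\<lambda>t. t) b)" using fold by blast
    have "norm (commutator f b) \<le> norm (fc f b) + norm (rfc f b)"
      unfolding commutator_def by (rule norm_triangle_ineq4)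
    then show ?thesis
      using norm_fc_le[OF f(1,2), of b] norm_rfc_le[OF f(1,2), of b] f(3) by linarith
  qed
  moreover have "(\<lambda>n. M / 2 ^ n * norm b + M / 2 ^ n * norm b) \<longlonglongrightarrow> 0"
    by (intro tendsto_add_zero tendsto_mult_left_zero LIMSEQ_divide_realpow_zero) simp_all
  ultimately have "norm (commutator (\<lambda>t. t) b) \<le> 0"
    by (intro LIMSEQ_le_const) auto
  then show ?thesis
    by (simp add: commutator_def rfc_def fc_id st_times st_st self_adjoint)
qed

end

end

section \<open>Commutativity without square-zero elements, and matrix units from one\<close>

context cstar
begin

text \<open>Up to factors, the real and imaginary parts of \<open>a\<close> are \<open>u\<close> and
  \<open>v\<close>; both are self-adjoint, hence central.\<close>

theorem commutative_if_reduced: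
  assumes reduced: "\<And>x::'a. x * x = 0 \<Longrightarrow> x = 0"
  shows "a * b = b * (a::'a)"
proof -
  have central: "h * b = b * h" if "st h = h" for h
    using functional_calculus.H_central[OF functional_calculus_self_adjoint[OF that] reduced] .
  define u v where "u = a + st a" and "v = sm \<i> (a - st a)"
  have u: "u * b = b * u"
    by (rule central) (simp add: u_def st_add st_st add.commute)
  have "st v = v"
    using sm_minus_right[of "- \<i>" "a - st a"] sm_mult[of "-1" "\<i>" "a - st a"] sm_real[of "-1"]
    by (simp add: v_def st_sm st_diff st_st)
  then have "v * b = b * v" by (rule central)
  then have "sm (- \<i>) v * b = b * sm (- \<i>) v"
    by (simp add: sm_times_left[symmetric] sm_times_right[symmetric])
  moreover have "sm (- \<i>) v = a - st a"
    by (simp add: v_def sm_mult[symmetric] sm_one)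
  ultimately have "(u + (a - st a)) * b = b * (u + (a - st a))"
    using u by (simp add: algebra_simps)
  moreover have "u + (a - st a) = 2 *\<^sub>R a" by (simp add: u_def scaleR_2)
  ultimately show ?thesis by simp
qed

text \<open>In the model case of \<open>2 \<times> 2\<close> matrices, \<open>a\<close> is the matrix unit \<open>e\<^sub>2\<^sub>1\<close> and \<open>l\<close> is \<open>e\<^sub>1\<^sub>1\<close>.\<close>

lemma matrix_unit_exists:
  assumes x: "x * x = 0" "x \<noteq> (0::'a)"
  obtains a l where "a * a = 0" "norm (st a * a + a * st a) \<le> 1" "st a * l = 0"
    "st a * (a * l) = l" "l \<noteq> 0"
proof -
  define y where "y = x /\<^sub>R norm x"
  have yy: "y * y = 0" and norm_y: "norm y = 1"
    using x by (simp_all add: y_def)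
  have stst: "st y * st y = 0"
    using arg_cong[OF yy, of st] by (simp add: st_times st_zero)
  \<comment> \<open>As y^2 = 0, the square of \<open>s\<close> is y* y + y y*. Being the square of a
    self-adjoint element, \<open>H\<close> has a calculus on a nonnegative interval.\<close>
  define s h H where "s = y + st y" and "h = st y * y" and "H = s * s"
  have s: "st s = s" by (simp add: s_def st_add st_st add.commute)
  interpret functional_calculus sm st H 0 "(norm s)\<^sup>2"
    unfolding H_def by (rule functional_calculus_square[OF s])
  have H: "H = st y * y + y * st y"
    by (simp add: H_def s_def algebra_simps yy stst)
  have yy0: "y * (y * c) = 0" "st y * (st y * c) = 0" for c
    by (simp_all add: mult.assoc[symmetric] yy stst)
  have yH: "y * H = H * y" and sH: "st y * H = H * st y" and Hh: "H * h = h * h"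
    and hH: "h * H = H * h"
    by (simp_all add: H h_def algebra_simps yy stst yy0)
  have h: "st h = h" "norm h = 1"
    by (simp_all add: h_def st_times st_st norm_st_times norm_y)
  \<comment> \<open>\<open>k t\<close> is t^(-1/2) for t \<ge> 1/2 and constant below;
    \<open>lam\<close> lives on t \<ge> 1/2. Thus a = k(H) y behaves as a partial isometry where
    \<open>lam\<close> is nonzero.\<close>
  define k lam where "k t = 1 / sqrt (max t (1/2))" and "lam t = max (t - 1/2) 0" for t :: real
  have nz: "sqrt (max t (1/2)) \<noteq> 0" for t :: real by auto
  have k: "continuous_on {0..(norm s)\<^sup>2} k"
    unfolding k_def by (intro continuous_intros) (use nz in blast)
  have lam: "continuous_on {0..(norm s)\<^sup>2} lam"
    unfolding lam_def by (intro continuous_intros)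
  have kk: "continuous_on {0..(norm s)\<^sup>2} (\<lambda>t. k t * k t)" by (intro continuous_intros k)
  have id: "continuous_on {0..(norm s)\<^sup>2} (\<lambda>t. t)" by (intro continuous_intros)
  have k2: "k t * k t = 1 / max t (1/2)" for t
    by (simp add: k_def max_def)
  define a l where "a = fc k y" and "l = fc lam h"
  have sta: "st a = fc k (st y)" by (simp add: a_def st_fc[OF k yH])
  have ac: "a * c = fc k (y * c)" "st a * c = fc k (st y * c)" for c
    unfolding sta by (simp_all add: a_def fc_times[OF k])
  define K where "K = st a * a + a * st a"
  have "K = fc k (fc k (st y * y)) + fc k (fc k (y * st y))"
    unfolding K_def ac unfolding sta unfolding a_def
    by (simp only: fc_commute[OF k sH] fc_commute[OF k yH])
  also have "\<dots> = fc (\<lambda>t. k t * k t) (st y * y + y * st y)"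
    by (simp add: fc_mult[OF k k] fc_add_right[OF k])
  finally have K: "K = fc (\<lambda>t. k t * k t) H"
    using arg_cong[OF H, of "fc (\<lambda>t. k t * k t)"] by simp
  have stK: "st K = K" by (simp add: K_def st_add st_times st_st)
  \<comment> \<open>The function k^2 t is at most 1 on the interval, so
    \<open>norm (K * K) \<le> norm K\<close>; as K is self-adjoint, the left side is the square of
    \<open>norm K\<close>.\<close>
  have "K * K = fc (\<lambda>t. k t * k t) (H * K)"
    by (simp add: K fc_times[OF kk])
  also have "\<dots> = fc (\<lambda>t. k t * k t * t) K"
    by (simp add: fc_mult[OF kk id] fc_id)
  finally have "norm (K * K) \<le> 1 * norm K"
    using norm_fc_le[OF continuous_on_mult[OF kk id], of 1 K] by (auto simp: k2)
  moreover have "norm (K * K) = norm K * norm K"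
    using norm_st_times[of K] by (simp add: stK power2_eq_square)
  ultimately have normK: "norm K \<le> 1"
    by (cases "K = 0") (auto intro: mult_right_le_imp_le)
  show thesis
  proof
    show "a * a = 0"
      by (simp add: ac) (simp add: a_def fc_commute[OF k yH, symmetric] yy fc_zero_right[OF k])
    show "norm (st a * a + a * st a) \<le> 1" using normK by (simp add: K_def)
    show "st a * l = 0"
      by (simp add: ac l_def fc_commute[OF lam sH, symmetric] h_def yy0 fc_zero_right lam k)
    have "st a * (a * l) = fc k (fc k (h * l))"
      by (simp add: ac fc_commute[OF k sH, symmetric] h_def mult.assoc)
    also have "h * l = fc lam (fc (\<lambda>t. t) h)"
      by (simp add: l_def fc_commute[OF lam hH, symmetric] Hh fc_id)
    also have "\<dots> = fc (\<lambda>t. lam t * t) h"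
      by (simp add: fc_mult[OF lam id])
    also have "fc k (fc k \<dots>) = fc (\<lambda>t. k t * k t * (lam t * t)) h"
      by (simp add: fc_mult k kk lam id continuous_on_mult)
    also have "\<dots> = fc lam h"
    proof -
      have "k t * k t * (lam t * t) = lam t" for t
        by (simp add: k2 lam_def max_def)
      then show ?thesis by (simp only:)
    qed
    finally show "st a * (a * l) = l" by (simp add: l_def)
    \<comment> \<open>If lam(H) h vanished, \<open>H\<close> would act on \<open>h\<close> as min(H,
      1/2), with norm at most 1/2; but \<open>H * h = h * h\<close> has norm 1.\<close>
    show "l \<noteq> 0"
    proof
      assume l: "l = 0"
      have m: "continuous_on {0..(norm s)\<^sup>2} (\<lambda>t. min t (1/2))" by (intro continuous_intros)
      have "(\<lambda>t::real. t) = (\<lambda>t. min t (1/2) + lam t)" by (auto simp: lam_def)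
      then have "H * h = fc (\<lambda>t. min t (1/2)) h + l"
        using fc_add[OF m lam, of h] by (simp add: l_def fc_id[symmetric])
      then have "norm (H * h) \<le> 1/2 * norm h"
        using norm_fc_le[OF m, of "1/2" h] l by auto
      moreover have "norm (H * h) = 1"
        using norm_st_times[of h] by (simp add: Hh h)
      ultimately show False by (simp add: h)
    qed
  qed
qed

end

section \<open>Representations of commutative algebras by characters\<close>

context cstar
begin

text \<open>In the commutative case (a a)* (a a) is the square of the self-adjoint element a* a, to
  which the C*-identity applies again.\<close>

lemma pm_seminorm_norm:
  assumes "\<And>a b::'a. a * b = b * a"
  shows "pm_seminorm sm (norm :: 'a \<Rightarrow> real)"
proof (rule pm_seminormI)
  fix a :: 'a
  let ?q = "st a * a"
  have "(norm (a * a))\<^sup>2 = norm (st (a * a) * (a * a))"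
    by (simp only: norm_st_times)
  also have "st (a * a) * (a * a) = ?q * ?q"
    by (simp add: st_times mult.assoc) (metis assms mult.assoc)
  also have "norm (?q * ?q) = (norm ?q)\<^sup>2"
    using norm_st_times[of ?q] by (simp add: st_times st_st)
  finally have "(norm (a * a))\<^sup>2 = ((norm a)\<^sup>2)\<^sup>2"
    by (simp only: norm_st_times)
  then show "norm (a * a) = (norm a)\<^sup>2"
    by (rule power2_eq_imp_eq) simp_all
qed (simp_all add: norm_triangle_ineq norm_sm norm_mult_ineq)

definition characters :: "('a \<Rightarrow> complex) set" where
  "characters = {\<phi>. (\<forall>a b. \<phi> (a + b) = \<phi> a + \<phi> b) \<and> (\<forall>c a. \<phi> (sm c a) = c * \<phi> a) \<and>
     (\<forall>a b. \<phi> (a * b) = \<phi> a * \<phi> b) \<and> (\<forall>a. cmod (\<phi> a) \<le> norm a)}"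

lemma norm_attained:
  assumes comm: "\<And>a b::'a. a * b = b * a"
  obtains \<phi> where "\<phi> \<in> characters" "cmod (\<phi> a) = norm a"
proof (cases "a = 0")
  case True
  then show thesis by (intro that[of "\<lambda>_. 0"]) (auto simp: characters_def)
next
  case False
  interpret comm_complex_algebra sm
    by unfold_locales (simp_all add: sm_add sm_plus sm_mult sm_one sm_times_left comm)
  have "norm (a /\<^sub>R norm a) = 1" using False by simp
  then obtain \<phi> where \<phi>: "\<And>a b. \<phi> (a + b) = \<phi> a + \<phi> b" "\<And>c a. \<phi> (sm c a) = c * \<phi> a"
    "\<And>a b. \<phi> (a * b) = \<phi> a * \<phi> b" "\<And>a. cmod (\<phi> a) \<le> norm a" "cmod (\<phi> (a /\<^sub>R norm a)) = 1"
    using character_exists[OF pm_seminorm_norm[OF comm]] by blast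
  have "\<phi> (a /\<^sub>R norm a) = of_real (inverse (norm a)) * \<phi> a"
    using \<phi>(2)[of "of_real (inverse (norm a))" a] by (simp only: sm_real)
  then have "inverse (norm a) * cmod (\<phi> a) = 1"
    using \<phi>(5) by (simp only: norm_mult norm_of_real abs_inverse abs_norm_cancel)
  then have "cmod (\<phi> a) = norm a"
    using False by (simp add: field_simps)
  then show thesis using \<phi> by (intro that[of \<phi>]) (auto simp: characters_def)
qed

text \<open>The zero functional is one of the \<open>characters\<close>, so the measure space is never empty; the
  lower bound for the operator norm needs this when the algebra is zero.\<close>

theorem commutative_isometric_Lp_rep:
  assumes comm: "\<And>a b::'a. a * b = b * a" and p: "1 \<le> p"
  shows "isometric_Lp_rep (count_space characters) p sm (\<lambda>a f \<phi>. \<phi> a * f \<phi>)"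
proof -
  let ?M = "count_space characters" and ?\<pi> = "\<lambda>(a::'a) f \<phi>. \<phi> a * f \<phi> :: complex"
  have le: "cmod (?\<pi> a f \<phi>) powr p \<le> norm a powr p * cmod (f \<phi>) powr p"
    if "\<phi> \<in> characters" for a f \<phi>
    using that p by (auto simp: norm_mult characters_def powr_mult[symmetric]
        intro!: powr_mono2 mult_right_mono)
  have int: "integrable ?M (\<lambda>\<phi>. norm a powr p * cmod (f \<phi>) powr p)" if "f \<in> Lp_space ?M p" for a f
    using that by (simp add: Lp_space_def)
  have mem: "?\<pi> a f \<in> Lp_space ?M p" if "f \<in> Lp_space ?M p" for a f
    using Bochner_Integration.integrable_bound[OF int[OF that, of a], of "\<lambda>\<phi>. cmod (?\<pi> a f \<phi>) powr p"] le
    by (auto simp: Lp_space_def AE_count_space)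
  have upper: "Lp_norm ?M p (?\<pi> a f) \<le> norm a * Lp_norm ?M p f" if f: "f \<in> Lp_space ?M p" for a f
  proof -
    have "(\<integral>\<phi>. cmod (?\<pi> a f \<phi>) powr p \<partial>?M) \<le> (\<integral>\<phi>. norm a powr p * cmod (f \<phi>) powr p \<partial>?M)"
      using mem[OF f, of a] le by (intro integral_mono int f) (auto simp: Lp_space_def)
    then have "Lp_norm ?M p (?\<pi> a f) \<le> (norm a powr p * (\<integral>\<phi>. cmod (f \<phi>) powr p \<partial>?M)) powr (1 / p)"
      unfolding Lp_norm_def using p by (intro powr_mono2) auto
    also have "\<dots> = norm a * Lp_norm ?M p f"
      using p by (simp add: Lp_norm_def powr_mult powr_powr)
    finally show ?thesis .
  qed
  have lower: "norm a \<le> K"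
    if K: "\<forall>f\<in>Lp_space ?M p. Lp_norm ?M p (?\<pi> a f) \<le> K * Lp_norm ?M p f" for a K
  proof -
    obtain \<phi> where \<phi>: "\<phi> \<in> characters" "cmod (\<phi> a) = norm a" using norm_attained[OF comm] .
    \<comment> \<open>The point mass at a character attaining \<open>norm a\<close> is an
      eigenvector that realises the norm.\<close>
    define f where "f = (\<lambda>\<psi>. indicator {\<phi>} \<psi> :: complex)"
    have f: "cmod (f \<psi>) powr p = indicator {\<phi>} \<psi>" for \<psi>
      using p by (simp add: f_def indicator_def)
    have af: "cmod (?\<pi> a f \<psi>) powr p = norm a powr p * indicator {\<phi>} \<psi>" for \<psi>
      using p \<phi> by (simp add: f_def indicator_def)
    have "f \<in> Lp_space ?M p"
      using \<phi> by (simp add: Lp_space_def f integrable_indicator_iff)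
    moreover have "Lp_norm ?M p f = 1" "Lp_norm ?M p (?\<pi> a f) = norm a"
      unfolding Lp_norm_def f af using \<phi> p
      by (simp_all add: powr_powr measure_def Int_absorb1)
    ultimately show ?thesis using K by fastforce
  qed
  show ?thesis
    unfolding isometric_Lp_rep_def
  proof (intro conjI allI ballI impI)
    fix a f assume "f \<in> Lp_space ?M p"
    then show "?\<pi> a f \<in> Lp_space ?M p" "Lp_norm ?M p (?\<pi> a f) \<le> norm a * Lp_norm ?M p f"
      by (simp_all add: mem upper)
  next
    fix a K assume "\<forall>f\<in>Lp_space ?M p. Lp_norm ?M p (?\<pi> a f) \<le> K * Lp_norm ?M p f"
    then show "norm a \<le> K" by (rule lower)
  qed (auto simp: AE_count_space characters_def algebra_simps)
qed

end

section \<open>A pointwise extremal problem\<close>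

lemma norm_powr_midpoint:
  fixes u v :: complex
  assumes p: "1 \<le> p"
  shows "2 * cmod ((u + v) / 2) powr p \<le> cmod u powr p + cmod v powr p"
proof -
  have half: "2 * (y / 2) powr p \<le> y powr p" if "y \<ge> 0" for y :: real
  proof -
    have "(1 / 2) powr p \<le> (1 / 2 :: real) powr 1" using p by (intro powr_mono') auto
    then have "2 * ((1 / 2) powr p * y powr p) \<le> 2 * (1 / 2 * y powr p)"
      by (intro mult_left_mono mult_right_mono) auto
    then show ?thesis using that by (simp add: powr_mult[symmetric])
  qed
  have conv: "2 * ((x + y) / 2) powr p \<le> x powr p + y powr p" if "x \<ge> 0" "y \<ge> 0" for x y :: real
  proof (cases "x = 0 \<or> y = 0")
    case True
    then show ?thesis using half[OF that(1)] half[OF that(2)] p by auto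
  next
    case False
    then have "((1 - 1/2) *\<^sub>R x + (1/2) *\<^sub>R y) powr p \<le> (1 - 1/2) * x powr p + (1/2) * y powr p"
      using that by (intro convex_onD[OF powr_convex[OF p]]) auto
    then show ?thesis by (simp add: add_divide_distrib)
  qed
  have "cmod ((u + v) / 2) powr p \<le> ((cmod u + cmod v) / 2) powr p"
    using p norm_triangle_ineq[of u v] by (intro powr_mono2) (auto simp: norm_divide)
  then show ?thesis using conv[of "cmod u" "cmod v"] by simp
qed

lemma norm_add_powr_le:
  fixes u v :: complex
  assumes p: "1 \<le> p"
  shows "cmod (u + v) powr p \<le> 2 powr p * (cmod u powr p + cmod v powr p)"
proof -
  have "cmod (u + v) powr p = 2 powr p * cmod ((u + v) / 2) powr p"
    by (simp add: powr_mult[symmetric] norm_divide)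
  also have "\<dots> \<le> 2 powr p * (cmod u powr p + cmod v powr p)"
  proof (rule mult_left_mono)
    show "cmod ((u + v) / 2) powr p \<le> cmod u powr p + cmod v powr p"
      using norm_powr_midpoint[OF p, of u v] powr_ge_zero[of "cmod ((u + v) / 2)" p] by linarith
  qed simp
  finally show ?thesis .
qed

text \<open>Inequalities valid almost everywhere can be collected only over countably many
  parameters; continuity supplies the rest.\<close>

lemma min_if_rational_min:
  fixes F :: "real \<Rightarrow> real"
  assumes F: "continuous_on UNIV F" and q: "\<And>r. r \<in> \<rat> \<Longrightarrow> F 0 \<le> F r"
  shows "F 0 \<le> F r"
proof (rule ccontr)
  assume *: "\<not> F 0 \<le> F r"
  have "open {r. F r < F 0}" by (intro open_Collect_less F continuous_on_const)
  then obtain e where e: "e > 0" "ball r e \<subseteq> {r. F r < F 0}"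
    using * by (auto simp: not_le elim: openE)
  obtain s where "s \<in> \<rat>" "r < s" "s < r + e"
    using Rats_dense_in_real[of r "r + e"] e(1) by auto
  moreover from this have "s \<in> ball r e" by (simp add: dist_real_def)
  ultimately show False using q[of s] e(2) by fastforce
qed

text \<open>Dividing by \<open>s\<close> leaves w = \<gamma> t / s. If t = 0, the derivative in the
  real direction is a multiple of (1/sqrt 2)^(p-1) - 1/sqrt 2, nonzero unless p = 2. Otherwise the
  imaginary direction is used: the third term is stationary at 0, and for Im w \<noteq> 0 the first
  two force |1 + w| = |1 - w|, that is Re w = 0.\<close>

lemma eq_0_if_stationary:
  fixes s t :: complex
  assumes p: "1 \<le> p" "p \<noteq> 2"
    and min: "\<And>\<gamma> c r. \<gamma> \<in> {1, cis (pi / 4)} \<Longrightarrow> c \<in> {1, \<i>} \<Longrightarrow> r \<in> \<rat> \<Longrightarrow>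
      cmod ((s + \<gamma> * t) / sqrt 2) powr p + cmod ((s - \<gamma> * t) / sqrt 2) powr p + 2 * cmod s powr p
      \<le> cmod ((s + \<gamma> * t) / sqrt 2 + c * of_real r * s) powr p
        + cmod ((s - \<gamma> * t) / sqrt 2 + c * of_real r * s) powr p
        + 2 * cmod (s - c * of_real r * s / sqrt 2) powr p"
  shows "s = 0"
proof (rule ccontr)
  assume s: "s \<noteq> 0"
  define \<tau> where "\<tau> = t / s"
  define F where "F \<gamma> c r = cmod ((1 + \<gamma> * \<tau>) / sqrt 2 + c * of_real r) powr p
        + cmod ((1 - \<gamma> * \<tau>) / sqrt 2 + c * of_real r) powr p
        + 2 * cmod (1 - c * of_real r / sqrt 2) powr p" for \<gamma> c and r :: real
  have t: "t = \<tau> * s" using s by (simp add: \<tau>_def)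
  have cont: "continuous_on UNIV (F \<gamma> c)" for \<gamma> c
  proof -
    have *: "continuous_on UNIV (\<lambda>r. cmod (g r) powr p)" if "continuous_on UNIV g"
      for g :: "real \<Rightarrow> complex"
      by (rule continuous_on_powr'[OF continuous_on_norm[OF that] continuous_on_const]) (use p in auto)
    show ?thesis
      unfolding F_def by (intro continuous_on_add continuous_on_mult_left *) (intro continuous_intros, simp?)+
  qed
  have minF: "F \<gamma> c 0 \<le> F \<gamma> c r" if g: "\<gamma> \<in> {1, cis (pi / 4)}" "c \<in> {1, \<i>}" for \<gamma> c r
  proof (rule min_if_rational_min[OF cont])
    fix r :: real assume r: "r \<in> \<rat>"
    have fac: "(s + \<gamma> * t) / sqrt 2 + c * of_real r * s = ((1 + \<gamma> * \<tau>) / sqrt 2 + c * of_real r) * s"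
      "(s - \<gamma> * t) / sqrt 2 + c * of_real r * s = ((1 - \<gamma> * \<tau>) / sqrt 2 + c * of_real r) * s"
      "s - c * of_real r * s / sqrt 2 = (1 - c * of_real r / sqrt 2) * s"
      for r
      by (simp_all add: t ring_distribs add_divide_distrib diff_divide_distrib)
    have E: "cmod ((s + \<gamma> * t) / sqrt 2 + c * of_real r * s) powr p
        + cmod ((s - \<gamma> * t) / sqrt 2 + c * of_real r * s) powr p
        + 2 * cmod (s - c * of_real r * s / sqrt 2) powr p = F \<gamma> c r * cmod s powr p" for r
      unfolding fac norm_mult F_def by (simp only: powr_mult norm_ge_zero distrib_right mult.assoc)
    have "F \<gamma> c 0 * cmod s powr p \<le> F \<gamma> c r * cmod s powr p"
      using min[OF g r] E[of r] E[of 0] by simp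
    then show "F \<gamma> c 0 \<le> F \<gamma> c r" using s by simp
  qed
  show False
  proof (cases "\<tau> = 0")
    case True
    define f where "f r = 2 * (1 / sqrt 2 + r) powr p + 2 * (1 - r / sqrt 2) powr p" for r :: real
    have half: "1 / 2 < 1 / sqrt 2" "sqrt 2 < 2"
      using real_sqrt_less_mono[of 2 4] by (auto simp: field_simps)
    have eq: "F 1 1 r = f r" if "\<bar>r\<bar> < 1 / 2" for r
    proof -
      have "\<bar>r / sqrt 2\<bar> \<le> \<bar>r\<bar>" by (simp add: field_simps mult_le_cancel_left1)
      then have "0 \<le> 1 / sqrt 2 + r" "0 \<le> 1 - r / sqrt 2" using that half by linarith+
      moreover have "complex_of_real (1 / sqrt 2 + r) = 1 / sqrt 2 + of_real r"
        "complex_of_real (1 - r / sqrt 2) = 1 - of_real r / sqrt 2" by simp_all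
      ultimately have "cmod (1 / sqrt 2 + of_real r) = 1 / sqrt 2 + r" "cmod (1 - of_real r / sqrt 2) = 1 - r / sqrt 2"
        by (metis norm_of_real abs_of_nonneg)+
      then show ?thesis by (simp add: F_def f_def True)
    qed
    have "(f has_real_derivative 2 * (p * (1 / sqrt 2) powr (p - 1)) + 2 * (p * 1 powr (p - 1) * (- 1 / sqrt 2))) (at 0)"
      unfolding f_def by (auto intro!: derivative_eq_intros) (simp add: field_simps)
    then have "2 * (p * (1 / sqrt 2) powr (p - 1)) + 2 * (p * 1 powr (p - 1) * (- 1 / sqrt 2)) = 0"
    proof (rule DERIV_local_min[where d = "1/2"])
      show "\<forall>y. \<bar>0 - y\<bar> < 1/2 \<longrightarrow> f 0 \<le> f y"
        using minF[of 1 1] eq by (metis abs_0 abs_minus_cancel diff_0 half_gt_zero insertI1 zero_less_one)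
    qed simp
    then have "(1 / sqrt 2) powr (p - 1) = (1 / sqrt 2) powr 1"
      using p by (simp add: field_simps)
    then have "p - 1 = 1" by (subst (asm) powr_inj) (use half in auto)
    then show False using p by simp
  next
    case False
    \<comment> \<open>If \<tau> lies on an axis, an eighth of a turn moves it off both. Then Im w
      \<noteq> 0 keeps \<open>X\<close> and \<open>Y\<close> positive, so the powers are
      differentiable even for \<open>p = 1\<close>, and Re w \<noteq> 0 will be
      contradicted.\<close>
    obtain \<gamma> where \<gamma>: "\<gamma> \<in> {1, cis (pi / 4)}" and re: "Re (\<gamma> * \<tau>) \<noteq> 0" and im: "Im (\<gamma> * \<tau>) \<noteq> 0"
    proof (cases "Re \<tau> = 0 \<or> Im \<tau> = 0")
      case True
      then show thesis
        using False by (intro that[of "cis (pi / 4)"]) (auto simp: cos_45 sin_45 complex_eq_iff)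
    qed (auto intro: that[of 1])
    define w where "w = \<gamma> * \<tau>"
    define a b where "a = Re w" and "b = Im w"
    define X Y where "X = ((1 + a) / sqrt 2)\<^sup>2 + (b / sqrt 2)\<^sup>2" and "Y = ((1 - a) / sqrt 2)\<^sup>2 + (b / sqrt 2)\<^sup>2"
    have pos: "X > 0" "Y > 0" using im by (simp_all add: X_def Y_def b_def w_def add_nonneg_pos del: times_complex.sel)
    have sq: "cmod z powr p = ((Re z)\<^sup>2 + (Im z)\<^sup>2) powr (p / 2)" for z
      by (simp add: cmod_def powr_half_sqrt[symmetric] powr_powr)
    have F: "F \<gamma> \<i> = (\<lambda>r. (((1 + a) / sqrt 2)\<^sup>2 + (b / sqrt 2 + r)\<^sup>2) powr (p / 2)
        + (((1 - a) / sqrt 2)\<^sup>2 + (r - b / sqrt 2)\<^sup>2) powr (p / 2)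
        + 2 * (1 + (r / sqrt 2)\<^sup>2) powr (p / 2))"
      by (simp add: F_def fun_eq_iff sq a_def b_def add.commute flip: w_def)
    have "(F \<gamma> \<i> has_real_derivative
        (p / 2 * X powr (p / 2 - 1) * (2 * (b / sqrt 2))
         + p / 2 * Y powr (p / 2 - 1) * (2 * (- b / sqrt 2)) + 0)) (at 0)"
      unfolding F using pos by (auto intro!: derivative_eq_intros simp: X_def Y_def)
    then have "p / 2 * X powr (p / 2 - 1) * (2 * (b / sqrt 2))
         + p / 2 * Y powr (p / 2 - 1) * (2 * (- b / sqrt 2)) + 0 = 0"
      by (rule DERIV_local_min[where d = 1]) (use minF[OF \<gamma>, of \<i>] in auto)
    then have "(X powr (p / 2 - 1) - Y powr (p / 2 - 1)) * (p * b) = 0"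
      by (simp add: field_simps)
    then have "X powr (p / 2 - 1) = Y powr (p / 2 - 1)"
      using p im by (simp add: b_def w_def del: times_complex.sel)
    then have "(X powr (p / 2 - 1)) powr (1 / (p / 2 - 1)) = (Y powr (p / 2 - 1)) powr (1 / (p / 2 - 1))"
      by simp
    then have "X = Y" using pos p by (simp add: powr_powr)
    then have "a = 0" by (simp add: X_def Y_def power_divide power2_eq_square field_simps)
    then show False using re by (simp add: a_def w_def del: times_complex.sel)
  qed
qed

section \<open>Algebras acting isometrically on \<open>L\<^sup>p\<close>\<close>

lemma Lp_spaceD:
  assumes "f \<in> Lp_space M p"
  shows "f \<in> borel_measurable M" "integrable M (\<lambda>x. cmod (f x) powr p)"
  using assms by (auto simp: Lp_space_def)

lemma Lp_space_bound:
  assumes "g \<in> borel_measurable M" "integrable M h" "\<And>x. cmod (g x) powr p \<le> h x"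
  shows "g \<in> Lp_space M p"
  unfolding Lp_space_def
  using assms(1)
  by (auto intro!: Bochner_Integration.integrable_bound[OF assms(2)] order_trans[OF assms(3) abs_ge_self])

lemma Lp_space_add:
  assumes p: "1 \<le> p" and f: "f \<in> Lp_space M p" and g: "g \<in> Lp_space M p"
  shows "(\<lambda>x. f x + g x) \<in> Lp_space M p"
  using Lp_spaceD[OF f] Lp_spaceD[OF g]
  by (intro Lp_space_bound[OF _ _ norm_add_powr_le[OF p]]) auto

lemma Lp_space_mult_left:
  assumes f: "f \<in> Lp_space M p"
  shows "(\<lambda>x. c * f x) \<in> Lp_space M p"
  using Lp_spaceD[OF f]
  by (intro Lp_space_bound[where h = "\<lambda>x. cmod c powr p * cmod (f x) powr p"])
    (auto simp: norm_mult powr_mult)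

lemma Lp_space_indicator:
  assumes f: "f \<in> Lp_space M p" and B: "B \<in> sets M"
  shows "(\<lambda>x. if x \<in> B then f x else 0) \<in> Lp_space M p"
  using Lp_spaceD[OF f] B
  by (intro Lp_space_bound[where h = "\<lambda>x. cmod (f x) powr p"]) (auto intro!: measurable_If_set)

locale Lp_rep = cstar sm st
  for sm :: "complex \<Rightarrow> 'a::{real_normed_algebra,banach} \<Rightarrow> 'a" and st +
  fixes M :: "'m measure" and p :: real and \<pi> :: "'a \<Rightarrow> ('m \<Rightarrow> complex) \<Rightarrow> 'm \<Rightarrow> complex"
  assumes rep: "isometric_Lp_rep M p sm \<pi>" and p: "1 \<le> p"
begin

abbreviation "L \<equiv> Lp_space M p"

text \<open>The p-th power of the norm: it adds up over disjoint sets, so an inequality between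
  energies can be localised.\<close>

definition energy :: "('m \<Rightarrow> complex) \<Rightarrow> real" where
  "energy f = (\<integral>x. cmod (f x) powr p \<partial>M)"

lemma pi_in: "f \<in> L \<Longrightarrow> \<pi> a f \<in> L"
  and pi_add_arg: "f \<in> L \<Longrightarrow> g \<in> L \<Longrightarrow> AE x in M. \<pi> a (\<lambda>y. c * f y + g y) x = c * \<pi> a f x + \<pi> a g x"
  and pi_add: "f \<in> L \<Longrightarrow> AE x in M. \<pi> (a + b) f x = \<pi> a f x + \<pi> b f x"
  and pi_sm: "f \<in> L \<Longrightarrow> AE x in M. \<pi> (sm c a) f x = c * \<pi> a f x"
  and pi_mult: "f \<in> L \<Longrightarrow> AE x in M. \<pi> (a * b) f x = \<pi> a (\<pi> b f) x"
  and Lp_norm_pi_le: "f \<in> L \<Longrightarrow> Lp_norm M p (\<pi> a f) \<le> norm a * Lp_norm M p f"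
  and norm_le: "(\<And>f. f \<in> L \<Longrightarrow> Lp_norm M p (\<pi> a f) \<le> K * Lp_norm M p f) \<Longrightarrow> norm a \<le> K"
  using rep unfolding isometric_Lp_rep_def by simp_all

lemma energy_nonneg: "0 \<le> energy f"
  by (simp add: energy_def)

lemma energy_cong_AE:
  assumes "f \<in> L" "g \<in> L" "AE x in M. f x = g x"
  shows "energy f = energy g"
  unfolding energy_def using assms(3)
  by (intro integral_cong_AE) (auto intro!: borel_measurable_integrable Lp_spaceD(2)[OF assms(1)] Lp_spaceD(2)[OF assms(2)])

lemma energy_pi_le:
  assumes a: "norm a \<le> 1" and f: "f \<in> L"
  shows "energy (\<pi> a f) \<le> energy f"
proof -
  have "Lp_norm M p (\<pi> a f) \<le> 1 * Lp_norm M p f"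
    by (rule order_trans[OF Lp_norm_pi_le[OF f] mult_right_mono[OF a]]) (simp add: Lp_norm_def)
  then have "energy (\<pi> a f) powr (1 / p) \<le> energy f powr (1 / p)"
    by (simp add: Lp_norm_def energy_def)
  then have "(energy (\<pi> a f) powr (1 / p)) powr p \<le> (energy f powr (1 / p)) powr p"
    by (rule powr_mono2[rotated 2]) (use p in auto)
  then show ?thesis using p by (simp add: powr_powr energy_nonneg)
qed

lemma energy_midpoint:
  assumes u: "u \<in> L" and v: "v \<in> L"
  shows "2 * energy (\<lambda>x. (u x + v x) / 2) \<le> energy u + energy v"
proof -
  have "(\<lambda>x. (u x + v x) / 2) \<in> L"
    using Lp_space_mult_left[OF Lp_space_add[OF p u v], of "1/2"] by simp
  then have "(\<integral>x. 2 * cmod ((u x + v x) / 2) powr p \<partial>M) \<le> (\<integral>x. cmod (u x) powr p + cmod (v x) powr p \<partial>M)"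
    by (intro integral_mono norm_powr_midpoint[OF p] Bochner_Integration.integrable_add
        integrable_mult_right Lp_spaceD(2) u v)
  then show ?thesis
    using Lp_spaceD(2)[OF u] Lp_spaceD(2)[OF v] by (simp add: energy_def)
qed

lemma pi_plus_arg:
  assumes "f \<in> L" "g \<in> L"
  shows "AE x in M. \<pi> a (\<lambda>y. f y + g y) x = \<pi> a f x + \<pi> a g x"
  using pi_add_arg[OF assms, of a 1] by simp

text \<open>The energy of \<open>\<pi> (T\<^sub>i l) g + h\<close> is at least that of
  \<open>\<pi> l g + \<pi> T\<^sub>j h\<close>, where \<open>T\<^sub>j\<close> inverts \<open>T\<^sub>i\<close> on \<open>l\<close>; convexity and \<open>T\<^sub>1 + T\<^sub>2 = \<surd>2 K\<close> then turn the sum over \<open>i\<close> into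
  a bound involving \<open>h\<close> alone. No differentiability of the norm is used, so \<open>p = 1\<close> is included.\<close>

lemma energy_variation:
  assumes T: "norm T1 \<le> 1" "norm T2 \<le> 1" "norm K \<le> 1"
    and inv: "T1 * (T2 * l) = l" "T2 * (T1 * l) = l" "K * l = l"
    and sum: "T1 + T2 = sm (of_real (sqrt 2)) K"
    and g: "g \<in> L" and h: "h \<in> L"
  shows "energy (\<pi> (T2 * l) g) + energy (\<pi> (T1 * l) g) + 2 * energy (\<pi> l g)
    \<le> energy (\<lambda>x. \<pi> (T2 * l) g x + h x) + energy (\<lambda>x. \<pi> (T1 * l) g x + h x)
      + 2 * energy (\<lambda>x. \<pi> l g x - h x / sqrt 2)"
proof -
  let ?f = "\<pi> l g"
  have f: "?f \<in> L" using pi_in[OF g] .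
  note add = Lp_space_add[OF p]
  \<comment> \<open>The contraction \<pi>(S) carries \<open>\<pi> b g\<close> to
    \<open>\<pi> l g\<close>, which bounds the energy on the right from below.\<close>
  have step: "energy (\<lambda>x. \<pi> l g x + \<pi> S k x) \<le> energy (\<lambda>x. \<pi> b g x + k x)"
    if S: "norm S \<le> 1" "S * b = l" and k: "k \<in> L" for S b k
  proof -
    have "AE x in M. \<pi> S (\<lambda>x. \<pi> b g x + k x) x = \<pi> l g x + \<pi> S k x"
      using pi_plus_arg[OF pi_in[OF g, of b] k, of S] pi_mult[OF g, of S b] unfolding S(2) by eventually_elim simp
    then have "energy (\<lambda>x. \<pi> l g x + \<pi> S k x) = energy (\<pi> S (\<lambda>x. \<pi> b g x + k x))"
      using energy_cong_AE[OF pi_in[OF add[OF pi_in[OF g] k]] add[OF pi_in[OF g] pi_in[OF k]]] by simp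
    also have "\<dots> \<le> energy (\<lambda>x. \<pi> b g x + k x)"
      by (intro energy_pi_le[OF S(1)] add pi_in g k)
    finally show ?thesis .
  qed
  have base: "energy (\<pi> (S * l) g) \<le> energy ?f" if "norm S \<le> 1" for S
    using energy_pi_le[OF that f] energy_cong_AE[OF pi_in[OF g] pi_in[OF f] pi_mult[OF g, of S l]] by simp
  \<comment> \<open>Almost everywhere \<open>?w\<close> is the half-sum of \<pi>(T1) h and \<pi>(T2)
    h, and \<pi>(K) takes \<open>?k\<close> to the negative of \<open>?w\<close>.\<close>
  let ?k = "\<lambda>x. (- 1 / sqrt 2) * h x" and ?w = "\<lambda>x. \<pi> K h x / sqrt 2"
  have k: "?k \<in> L" by (rule Lp_space_mult_left[OF h])
  have w: "?w \<in> L" using Lp_space_mult_left[OF pi_in[OF h, of K], of "1 / sqrt 2"] by simp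
  have w': "(\<lambda>x. - ?w x) \<in> L" using Lp_space_mult_left[OF w, of "- 1"] by simp
  have "2 * energy (\<lambda>x. ?f x + ?w x) \<le> energy (\<lambda>x. ?f x + \<pi> T1 h x) + energy (\<lambda>x. ?f x + \<pi> T2 h x)"
  proof -
    have "AE x in M. ((?f x + \<pi> T1 h x) + (?f x + \<pi> T2 h x)) / 2 = ?f x + ?w x"
      using pi_add[OF h, of T1 T2] pi_sm[OF h, of "of_real (sqrt 2)" K]
    proof eventually_elim
      case (elim x)
      have "complex_of_real (sqrt 2) * complex_of_real (sqrt 2) = 2"
        by (simp flip: of_real_mult)
      then have "complex_of_real (sqrt 2) / 2 = 1 / complex_of_real (sqrt 2)"
        by (simp add: field_simps)
      then have "(\<pi> T1 h x + \<pi> T2 h x) / 2 = ?w x"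
        using elim unfolding sum by (metis mult.left_neutral times_divide_eq_left)
      then show ?case by (simp add: add_divide_distrib algebra_simps)
    qed
    then have "energy (\<lambda>x. ((?f x + \<pi> T1 h x) + (?f x + \<pi> T2 h x)) / 2) = energy (\<lambda>x. ?f x + ?w x)"
      using Lp_space_mult_left[OF add[OF add[OF f pi_in[OF h]] add[OF f pi_in[OF h]]], of "1/2" T1 T2]
      by (intro energy_cong_AE add f w) simp_all
    then show ?thesis
      using energy_midpoint[OF add[OF f pi_in[OF h, of T1]] add[OF f pi_in[OF h, of T2]]] by simp
  qed
  moreover have "2 * energy ?f \<le> energy (\<lambda>x. ?f x + ?w x) + energy (\<lambda>x. ?f x + - ?w x)"
    using energy_midpoint[OF add[OF f w] add[OF f w']] by simp
  moreover have "energy (\<lambda>x. ?f x + - ?w x) \<le> energy (\<lambda>x. ?f x - h x / sqrt 2)"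
  proof -
    have "AE x in M. \<pi> K ?k x = - ?w x"
    proof -
      have z: "(\<lambda>x. 0) \<in> L" by (simp add: Lp_space_def)
      have "AE x in M. \<pi> K (\<lambda>x. 0) x = 0"
        using pi_add_arg[OF z z, of K 1] by eventually_elim simp
      with pi_add_arg[OF h z, of K "- 1 / sqrt 2"] show ?thesis
        by eventually_elim simp
    qed
    then have "energy (\<lambda>x. ?f x + - ?w x) = energy (\<lambda>x. ?f x + \<pi> K ?k x)"
      by (intro energy_cong_AE add f w' pi_in k) auto
    also have "\<dots> \<le> energy (\<lambda>x. ?f x + ?k x)" by (rule step[OF T(3) inv(3) k])
    finally show ?thesis by simp
  qed
  ultimately show ?thesis
    using step[OF T(1) inv(1) h] step[OF T(2) inv(2) h] base[OF T(1)] base[OF T(2)] by linarith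
qed

text \<open>The energy inequality is tested with \<open>h\<close> equal to
  \<open>c * \<pi> l g\<close> on the set where the pointwise one fails and 0 elsewhere. It would be
  violated unless that set is null.\<close>

lemma pointwise_variation:
  fixes c :: complex
  assumes T: "norm T1 \<le> 1" "norm T2 \<le> 1" "norm K \<le> 1"
    and inv: "T1 * (T2 * l) = l" "T2 * (T1 * l) = l" "K * l = l"
    and sum: "T1 + T2 = sm (of_real (sqrt 2)) K"
    and g: "g \<in> L"
  shows "AE x in M. cmod (\<pi> (T2 * l) g x) powr p + cmod (\<pi> (T1 * l) g x) powr p + 2 * cmod (\<pi> l g x) powr p
    \<le> cmod (\<pi> (T2 * l) g x + c * \<pi> l g x) powr p + cmod (\<pi> (T1 * l) g x + c * \<pi> l g x) powr p
      + 2 * cmod (\<pi> l g x - c * \<pi> l g x / sqrt 2) powr p"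
proof -
  let ?u = "\<pi> (T2 * l) g" and ?v = "\<pi> (T1 * l) g" and ?f = "\<pi> l g"
  note add = Lp_space_add[OF p]
  have L: "?u \<in> L" "?v \<in> L" "?f \<in> L" using pi_in[OF g] by auto
  define G where "G w x = cmod (?u x + w) powr p + cmod (?v x + w) powr p + 2 * cmod (?f x - w / sqrt 2) powr p" for w x
  have int: "integrable M (\<lambda>x. G (h x) x)" "(\<integral>x. G (h x) x \<partial>M) =
      energy (\<lambda>x. ?u x + h x) + energy (\<lambda>x. ?v x + h x) + 2 * energy (\<lambda>x. ?f x - h x / sqrt 2)"
    if h: "h \<in> L" for h
  proof -
    have "(\<lambda>x. ?f x - h x / sqrt 2) \<in> L"
      using add[OF L(3) Lp_space_mult_left[OF h, of "- 1 / sqrt 2"]] by simp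
    note * = Lp_spaceD(2)[OF add[OF L(1) h]] Lp_spaceD(2)[OF add[OF L(2) h]] Lp_spaceD(2)[OF this]
    show "integrable M (\<lambda>x. G (h x) x)" "(\<integral>x. G (h x) x \<partial>M) =
      energy (\<lambda>x. ?u x + h x) + energy (\<lambda>x. ?v x + h x) + 2 * energy (\<lambda>x. ?f x - h x / sqrt 2)"
      unfolding G_def energy_def using * by simp_all
  qed
  have z: "(\<lambda>x. 0) \<in> L" by (simp add: Lp_space_def)
  have cf: "(\<lambda>x. c * ?f x) \<in> L" using Lp_space_mult_left[OF L(3)] .
  define B where "B = {x \<in> space M. G (c * ?f x) x < G 0 x}"
  have B: "B \<in> sets M"
    unfolding B_def using borel_measurable_integrable[OF int(1)[OF cf]] borel_measurable_integrable[OF int(1)[OF z]]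
    by measurable
  define h where "h x = (if x \<in> B then c * ?f x else 0)" for x
  have h: "h \<in> L" unfolding h_def by (rule Lp_space_indicator[OF cf B])
  have "(\<integral>x. G 0 x \<partial>M) \<le> (\<integral>x. G (h x) x \<partial>M)"
    using energy_variation[OF T inv sum g h] int(2)[OF h] int(2)[OF z] by simp
  then have "(\<integral>x. G 0 x - G (h x) x \<partial>M) \<le> 0"
    using int(1)[OF h] int(1)[OF z] by simp
  moreover have nn: "0 \<le> G 0 x - G (h x) x" for x
    by (auto simp: h_def B_def)
  moreover have "0 \<le> (\<integral>x. G 0 x - G (h x) x \<partial>M)"
    using nn by (rule Bochner_Integration.integral_nonneg)
  ultimately have "AE x in M. G 0 x - G (h x) x = 0"
    using integral_nonneg_eq_0_iff_AE[of M "\<lambda>x. G 0 x - G (h x) x"] int(1)[OF h] int(1)[OF z]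
    by (auto intro: antisym)
  then have "AE x in M. G 0 x \<le> G (c * ?f x) x"
    using AE_space by eventually_elim (auto simp: h_def B_def split: if_splits)
  then show ?thesis by (simp add: G_def)
qed

text \<open>Isometry supplies \<open>g\<close> with f1 = \<pi>(l) g nonzero. The contractions T1 and
  T2 rotate the plane of f1 and \<gamma> f2 by an eighth of a turn in opposite senses, and the
  pointwise variation makes f1 vanish almost everywhere.\<close>

theorem no_nilpotent:
  assumes p2: "p \<noteq> 2" and x: "x * x = (0::'a)"
  shows "x = 0"
proof (rule ccontr)
  assume "x \<noteq> 0"
  then obtain a l where a: "a * a = 0" and Kle: "norm (st a * a + a * st a) \<le> 1" and al: "st a * l = 0"
    "st a * (a * l) = l" and l: "l \<noteq> 0"
    using matrix_unit_exists[OF x] by blast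
  have sta: "st a * st a = 0" using arg_cong[OF a, of st] by (simp add: st_times st_zero)
  define K where "K = st a * a + a * st a"
  have K: "norm K \<le> 1" using Kle by (simp add: K_def)
  have stK: "st K = K" by (simp add: K_def st_add st_times st_st)
  have aK: "a * K = K * a" "st a * K = K * st a"
    by (simp_all add: K_def distrib_left distrib_right a sta flip: mult.assoc)
      (simp_all add: mult.assoc a sta)
  have Kl: "K * l = l" by (simp add: K_def distrib_right mult.assoc al)
  have Kal: "K * (a * l) = a * l" using aK(1) Kl by (metis mult.assoc)
  have nonzero: "\<exists>g\<in>L. energy (\<pi> l g) \<noteq> 0"
  proof (rule ccontr)
    assume "\<not> ?thesis"
    then have "norm l \<le> 0"
      using p by (intro norm_le) (auto simp: Lp_norm_def energy_def)
    with l show False by simp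
  qed
  then obtain g where g: "g \<in> L" "energy (\<pi> l g) \<noteq> 0" by blast
  define f1 f2 where "f1 = \<pi> l g" and "f2 = \<pi> (a * l) g"
  have main: "AE x in M. cmod ((f1 x + \<gamma> * f2 x) / sqrt 2) powr p + cmod ((f1 x - \<gamma> * f2 x) / sqrt 2) powr p
        + 2 * cmod (f1 x) powr p
      \<le> cmod ((f1 x + \<gamma> * f2 x) / sqrt 2 + c * f1 x) powr p
        + cmod ((f1 x - \<gamma> * f2 x) / sqrt 2 + c * f1 x) powr p
        + 2 * cmod (f1 x - c * f1 x / sqrt 2) powr p" if \<gamma>: "cmod \<gamma> = 1" for \<gamma> c
  proof -
    \<comment> \<open>\<open>y\<close> is skew-adjoint with square \<open>- K\<close>, a quarter
      turn on the plane of l and \<gamma> a l.\<close>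
    define y where "y = sm \<gamma> a - sm (cnj \<gamma>) (st a)"
    have gg: "\<gamma> * cnj \<gamma> = 1" using \<gamma> complex_norm_square[of \<gamma>] by simp
    have sty: "st y = - y" by (simp add: y_def st_diff st_sm st_st)
    have yy: "y * y = - K"
    proof -
      have "sm \<gamma> a * sm (cnj \<gamma>) (st a) = a * st a" "sm (cnj \<gamma>) (st a) * sm \<gamma> a = st a * a"
        by (metis gg sm_mult sm_one sm_times_left sm_times_right mult.commute)+
      moreover have "sm \<gamma> a * sm \<gamma> a = 0" "sm (cnj \<gamma>) (st a) * sm (cnj \<gamma>) (st a) = 0"
        by (metis a sta sm_times_left sm_times_right sm_zero_right)+
      ultimately show ?thesis by (simp add: y_def K_def algebra_simps)
    qed
    have yK: "y * K = K * y"
      by (simp add: y_def algebra_simps aK flip: sm_times_left sm_times_right)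
    have yl: "y * l = sm \<gamma> (a * l)"
      by (simp add: y_def left_diff_distrib al sm_zero_right flip: sm_times_left)
    define r where "r = 1 / sqrt 2"
    have rr: "r * r = 1 / 2" by (simp add: r_def)
    \<comment> \<open>These eighth turns are mutually adjoint, so the C*-identity reduces their
      norms to that of (K^2 + K)/2, which is at most 1.\<close>
    define T1 T2 where "T1 = r *\<^sub>R (K - y)" and "T2 = r *\<^sub>R (K + y)"
    have prod: "T1 * T2 = (1/2) *\<^sub>R (K * K + K)" "T2 * T1 = (1/2) *\<^sub>R (K * K + K)"
      by (simp_all add: T1_def T2_def rr algebra_simps yy yK)
    have st12: "st T1 = T2" "st T2 = T1"
      by (simp_all add: T1_def T2_def st_scaleR st_diff st_add stK sty)
    have "norm (K * K + K) \<le> 2"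
      using norm_triangle_ineq[of "K * K" K] norm_mult_ineq[of K K] mult_le_one[OF K norm_ge_zero K] K by linarith
    then have "(norm T1)\<^sup>2 \<le> 1" "(norm T2)\<^sup>2 \<le> 1"
      by (simp_all add: norm_st_times[symmetric] st12 prod)
    then have T: "norm T1 \<le> 1" "norm T2 \<le> 1"
      by (simp_all add: power_le_one_iff)
    have inv: "T1 * (T2 * l) = l" "T2 * (T1 * l) = l"
      by (simp_all add: prod distrib_right mult.assoc Kl flip: mult.assoc[of T1] mult.assoc[of T2] scaleR_2)
    have sum: "T1 + T2 = sm (of_real (sqrt 2)) K"
    proof -
      have "T1 + T2 = (r + r) *\<^sub>R K" 
        unfolding T1_def T2_def scaleR_add_left scaleR_add_right scaleR_diff_right by simp
      also have "r + r = sqrt 2" by (simp add: r_def field_simps)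
      finally show ?thesis by (simp only: sm_real)
    qed
    have T2l: "AE x in M. \<pi> (T2 * l) g x = (f1 x + \<gamma> * f2 x) / sqrt 2"
    proof -
      have e: "T2 * l = sm (of_real r) (l + sm \<gamma> (a * l))"
        by (simp add: T2_def sm_real distrib_right Kl yl)
      show ?thesis
        unfolding e using pi_sm[OF g(1), of "of_real r" "l + sm \<gamma> (a * l)"] pi_add[OF g(1), of l "sm \<gamma> (a * l)"]
        pi_sm[OF g(1), of \<gamma> "a * l"]
        by eventually_elim (simp add: f1_def f2_def r_def)
    qed
    have T1l: "AE x in M. \<pi> (T1 * l) g x = (f1 x - \<gamma> * f2 x) / sqrt 2"
    proof -
      have e: "T1 * l = sm (of_real r) (l + sm (- \<gamma>) (a * l))"
        using sm_plus[of "- \<gamma>" \<gamma> "a * l"]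
        by (simp add: T1_def sm_real left_diff_distrib Kl yl sm_zero eq_neg_iff_add_eq_0[symmetric])
      show ?thesis
        unfolding e using pi_sm[OF g(1), of "of_real r" "l + sm (- \<gamma>) (a * l)"] pi_add[OF g(1), of l "sm (- \<gamma>) (a * l)"]
        pi_sm[OF g(1), of "- \<gamma>" "a * l"]
        by eventually_elim (simp add: f1_def f2_def r_def)
    qed
    show ?thesis
      using pointwise_variation[OF T K inv Kl sum g(1), of c] T1l T2l
      unfolding f1_def[symmetric] by eventually_elim simp
  qed
  \<comment> \<open>Finitely many \<gamma> and c and countably many rationals leave a single null
    set.\<close>
  have "AE x in M. \<forall>\<gamma>\<in>{1, cis (pi / 4)}. \<forall>c\<in>{1, \<i>}. \<forall>q::rat.
      cmod ((f1 x + \<gamma> * f2 x) / sqrt 2) powr p + cmod ((f1 x - \<gamma> * f2 x) / sqrt 2) powr p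
        + 2 * cmod (f1 x) powr p
      \<le> cmod ((f1 x + \<gamma> * f2 x) / sqrt 2 + (c * of_real (of_rat q)) * f1 x) powr p
        + cmod ((f1 x - \<gamma> * f2 x) / sqrt 2 + (c * of_real (of_rat q)) * f1 x) powr p
        + 2 * cmod (f1 x - (c * of_real (of_rat q)) * f1 x / sqrt 2) powr p"
    by (intro AE_finite_allI) (auto simp: AE_all_countable intro!: main)
  then have "AE x in M. f1 x = 0"
  proof eventually_elim
    case (elim x)
    show ?case
      by (rule eq_0_if_stationary[OF p p2, of "f1 x" "f2 x"]) (use elim in \<open>auto elim!: Rats_cases\<close>)
  qed
  moreover have "f1 \<in> L" "(\<lambda>x. 0) \<in> L"
    using pi_in[OF g(1)] by (simp_all add: f1_def Lp_space_def)
  ultimately have "energy f1 = energy (\<lambda>x. 0)"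
    by (intro energy_cong_AE)
  then show False using g(2) p by (simp add: f1_def energy_def)
qed

end

text \<open>The point type of the measure space is arbitrary in one direction. In the other it is
  the type of complex functions on the algebra, among which the characters carry the counting
  measure.\<close>

theorem theorem5p3:
  fixes sm :: "complex \<Rightarrow> 'a::{real_normed_algebra,banach} \<Rightarrow> 'a"
    and st :: "'a \<Rightarrow> 'a"
    and p :: real
  assumes "cstar_algebra sm st"
    and "1 \<le> p" and "p \<noteq> 2"
  shows "(\<forall>(M::'m measure) \<pi>. isometric_Lp_rep M p sm \<pi> \<longrightarrow> commutative_alg TYPE('a)) \<and>
         (commutative_alg TYPE('a) \<longrightarrow>
            (\<exists>(M::('a \<Rightarrow> complex) measure) \<pi>. isometric_Lp_rep M p sm \<pi>))"
proof -
  interpret cstar sm st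
    using assms(1) unfolding cstar_algebra_def by unfold_locales metis+
  show ?thesis
  proof (intro conjI allI impI)
    fix M :: "'m measure" and \<pi>
    assume "isometric_Lp_rep M p sm \<pi>"
    then interpret Lp_rep sm st M p \<pi>
      using assms(2) by unfold_locales
    show "commutative_alg TYPE('a)"
      using commutative_if_reduced[OF no_nilpotent[OF assms(3)]] by (simp add: commutative_alg_def)
  next
    assume "commutative_alg TYPE('a)"
    then show "\<exists>(M::('a \<Rightarrow> complex) measure) \<pi>. isometric_Lp_rep M p sm \<pi>"
      using commutative_isometric_Lp_rep[OF _ assms(2)] unfolding commutative_alg_def by blast
  qed
qed

end
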